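(* Let $\mathbf S$ be a finite set and $\mathcal A=\{A_s\}_{s\in\mathbf S}\subset CQ(\mathbf X,\mathcal H)$ an AVcqC. Then $C_{A,d}(\mathcal A)=0$ if and only if $\mathcal A$ is m-symmetrizable.
   Context: $\mathbf X$ finite, $\mathcal H$ finite-dimensional complex Hilbert space, $CQ(\mathbf X,\mathcal H)$ the set of maps $\mathbf X\to\mathcal S(\mathcal H)$; $A_{s^l}(x^l):=A_{s_1}(x_1)\otimes\cdots\otimes A_{s_l}(x_l)$. An $(l,M_l)$ deterministic code is a family $(x_i^l,D_i^l)_{i=1}^{M_l}$ with $x_i^l\in\mathbf X^l$, $D_i^l\ge0$ on $\mathcal H^{\otimes l}$, $\sum_iD_i^l\le\mathbf 1$. $R\ge0$ is achievable under the maximal error criterion if there are $(l,M_l)$ deterministic codes with $\liminf_l\frac1l\log M_l\ge R$ and $\lim_{l}\max_{s^l\in\mathbf S^l}\max_{i\in[M_l]}\mathrm{tr}(A_{s^l}(x_i^l)(\mathbf 1-D_i^l))=0$; $C_{A,d}(\mathcal A)$ is the supremum of such $R$. $\mathcal A$ is called m-symmetrizable if for every $x,x'\in\mathbf X$, $\mathrm{conv}(\{A_s(x)\}_{s\in\mathbf S})\cap\mathrm{conv}(\{A_s(x')\}_{s\in\mathbf S})\neq\emptyset$. *)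

theory Defs
  imports "HOL-Analysis.Analysis" "Jordan_Normal_Form.Matrix"
begin

text \<open>Finite-dimensional Hilbert space H = C^d, operators = d x d complex matrices.\<close>

definition adj_mat :: "complex mat \<Rightarrow> complex mat" where
  "adj_mat A = mat (dim_col A) (dim_row A) (\<lambda>(i,j). cnj (A $$ (j,i)))"

definition mtrace :: "complex mat \<Rightarrow> complex" where
  "mtrace A = (\<Sum>i<dim_row A. A $$ (i,i))"

definition psd :: "nat \<Rightarrow> complex mat \<Rightarrow> bool" where
  "psd n A \<longleftrightarrow> A \<in> carrier_mat n n \<and> adj_mat A = A \<and>
     (\<forall>v \<in> carrier_vec n. Im (conjugate v \<bullet> (A *\<^sub>v v)) = 0 \<and> 0 \<le> Re (conjugate v \<bullet> (A *\<^sub>v v)))"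

definition density :: "nat \<Rightarrow> complex mat \<Rightarrow> bool" where
  "density n \<rho> \<longleftrightarrow> psd n \<rho> \<and> mtrace \<rho> = 1"

definition kron :: "complex mat \<Rightarrow> complex mat \<Rightarrow> complex mat" where
  "kron A B = mat (dim_row A * dim_row B) (dim_col A * dim_col B)
     (\<lambda>(i,j). A $$ (i div dim_row B, j div dim_col B) * B $$ (i mod dim_row B, j mod dim_col B))"

definition tensor_seq :: "nat \<Rightarrow> (nat \<Rightarrow> complex mat) \<Rightarrow> complex mat" where
  "tensor_seq l F = foldr kron (map F [0..<l]) (1\<^sub>m 1)"

definition mat_sum :: "nat \<Rightarrow> complex mat list \<Rightarrow> complex mat" where
  "mat_sum n Ms = foldr (+) Ms (0\<^sub>m n n)"

definition conv_mat :: "nat \<Rightarrow> complex mat set \<Rightarrow> complex mat set" where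
  "conv_mat n Ms = {C. \<exists>ps :: (real \<times> complex mat) list. ps \<noteq> [] \<and>
      (\<forall>(c,M) \<in> set ps. 0 \<le> c \<and> M \<in> Ms) \<and> sum_list (map fst ps) = 1 \<and>
      C = mat_sum n (map (\<lambda>(c,M). complex_of_real c \<cdot>\<^sub>m M) ps)}"

definition avcqc :: "'s set \<Rightarrow> 'x set \<Rightarrow> nat \<Rightarrow> ('s \<Rightarrow> 'x \<Rightarrow> complex mat) \<Rightarrow> bool" where
  "avcqc S X d A \<longleftrightarrow> (\<forall>s\<in>S. \<forall>x\<in>X. density d (A s x))"

definition m_symmetrizable :: "'s set \<Rightarrow> 'x set \<Rightarrow> nat \<Rightarrow> ('s \<Rightarrow> 'x \<Rightarrow> complex mat) \<Rightarrow> bool" where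
  "m_symmetrizable S X d A \<longleftrightarrow>
     (\<forall>x\<in>X. \<forall>x'\<in>X. conv_mat d ((\<lambda>s. A s x) ` S) \<inter> conv_mat d ((\<lambda>s. A s x') ` S) \<noteq> {})"

text \<open>(l, M) deterministic code: codewords cw i \<in> X^l (i < M), decoding operators D i
  on (C^d)^{\<otimes> l} = C^(d^l), D i \<ge> 0, \<Sum> D i \<le> 1.\<close>
definition det_code :: "'x set \<Rightarrow> nat \<Rightarrow> nat \<Rightarrow> nat \<Rightarrow> (nat \<Rightarrow> nat \<Rightarrow> 'x) \<Rightarrow> (nat \<Rightarrow> complex mat) \<Rightarrow> bool" where
  "det_code X d l M cw D \<longleftrightarrow>
     (\<forall>i<M. \<forall>k<l. cw i k \<in> X) \<and> (\<forall>i<M. psd (d^l) (D i)) \<and>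
     psd (d^l) (1\<^sub>m (d^l) - mat_sum (d^l) (map D [0..<M]))"

definition max_err :: "'s set \<Rightarrow> nat \<Rightarrow> ('s \<Rightarrow> 'x \<Rightarrow> complex mat) \<Rightarrow> nat \<Rightarrow> nat \<Rightarrow>
    (nat \<Rightarrow> nat \<Rightarrow> 'x) \<Rightarrow> (nat \<Rightarrow> complex mat) \<Rightarrow> real" where
  "max_err S d A l M cw D = Max {Re (mtrace (tensor_seq l (\<lambda>k. A (s k) (cw i k)) * (1\<^sub>m (d^l) - D i)))
      | s i. s \<in> {..<l} \<rightarrow>\<^sub>E S \<and> i < M}"

definition achievable_max :: "'s set \<Rightarrow> 'x set \<Rightarrow> nat \<Rightarrow> ('s \<Rightarrow> 'x \<Rightarrow> complex mat) \<Rightarrow> real \<Rightarrow> bool" where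
  "achievable_max S X d A R \<longleftrightarrow> 0 \<le> R \<and>
     (\<exists>(M :: nat \<Rightarrow> nat) (cw :: nat \<Rightarrow> nat \<Rightarrow> nat \<Rightarrow> 'x) (D :: nat \<Rightarrow> nat \<Rightarrow> complex mat).
        (\<forall>l. 1 \<le> M l \<and> det_code X d l (M l) (cw l) (D l)) \<and>
        ereal R \<le> liminf (\<lambda>l. ereal (log 2 (real (M l)) / real l)) \<and>
        (\<lambda>l. max_err S d A l (M l) (cw l) (D l)) \<longlonglongrightarrow> 0)"

definition cap_max_det :: "'s set \<Rightarrow> 'x set \<Rightarrow> nat \<Rightarrow> ('s \<Rightarrow> 'x \<Rightarrow> complex mat) \<Rightarrow> ereal" where
  "cap_max_det S X d A = Sup (ereal ` {R. achievable_max S X d A R})"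

end

theory Submission
  imports Defs
begin

text \<open>
  If the channel is m-symmetrizable, then at every position the jammer can mix the states so that
  two given codewords produce the same output, hence the same product output \<open>\<rho>\<close> on the whole
  block. Since \<open>D\<^sub>0 + D\<^sub>1 \<le> 1\<close>, one of the two codewords is decoded wrongly with probability at
  least \<open>1 / 2\<close> on \<open>\<rho>\<close>, and so also for some pure jamming sequence.

  Otherwise there are two letters whose output hulls are disjoint. A pair of closest points of the
  hulls yields an observable separating them, and mixing it with \<open>1 / 2\<close> gives a two-outcome
  measurement that identifies the letter with error probability at most \<open>1 / 2 - \<delta>\<close> whatever the
  jammer does. Measuring every position and decoding to the nearest codeword, the probability of
  confusing two codewords at Hamming distance \<open>h\<close> is at most \<open>q ^ h\<close> for some \<open>q < 1\<close> (Chernoff),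
  so a greedily chosen code of small positive rate suffices.
\<close>

subsection \<open>Positive semidefinite matrices\<close>

text \<open>The jammer has exponentially many sequences, and the maximal error criterion lets it
  choose one knowing the codeword. The direct part takes no union bound over these sequences: for
  each fixed one, a product state measured by product effects yields independent bits, and the
  Chernoff bound asks only that each bit be wrong with probability at most
  \<open>1 / 2 - \<delta>\<close>. In the converse the same freedom lets the jammer answer two
  codewords with different mixtures.

  The separating observable is a difference of two mixtures of states, hence Hermitian but of no
  particular sign. A small multiple of it, shifted by the threshold and added to half the identity,
  keeps both outcomes positive; as states have trace one, the threshold lands at
  \<open>1 / 2\<close>.

  Positivity is made explicit by writing matrices as sums of rank-one terms, which pass directly
  through traces and Kronecker products.

  For \<open>M\<close> codewords the greedy choice needs \<open>M * \<theta> ^ l \<le> 1\<close>,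
  and the same quantity bounds the error, so it must also tend to 0. Taking \<open>M\<close> close
  to \<open>\<theta> powr (- l / 2)\<close> meets both demands at a positive rate.\<close>

definition sesq :: "nat \<Rightarrow> (nat \<Rightarrow> nat \<Rightarrow> complex) \<Rightarrow> (nat \<Rightarrow> complex) \<Rightarrow> complex" where
  "sesq n a v = (\<Sum>i<n. \<Sum>j<n. cnj (v i) * a i j * v j)"

text \<open>Nonnegativity of the form along one coordinate direction becomes a quadratic condition
  in \<open>t\<close>, whose linear part is governed by row \<open>p\<close> applied to
  \<open>v\<close>.\<close>

lemma sesq_shift:
  fixes v :: "nat \<Rightarrow> complex"
  assumes herm: "\<And>i j. i < n \<Longrightarrow> j < n \<Longrightarrow> a j i = cnj (a i j)" and p: "p < n"
  defines "L \<equiv> \<Sum>j<n. a p j * v j"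
  shows "sesq n a (\<lambda>i. v i + (if i = p then t else 0)) =
    sesq n a v + cnj t * L + t * cnj L + t * cnj t * a p p"
proof -
  let ?e = "\<lambda>i. if i = p then t else 0"
  have "(\<Sum>j<n. ?e j * (\<Sum>i<n. cnj (v i) * a i j)) = (\<Sum>i<n. \<Sum>j<n. cnj (v i) * a i j * ?e j)"
    unfolding sum_distrib_left by (subst sum.swap) (simp only: mult_ac)
  then have "sesq n a (\<lambda>i. v i + ?e i) = sesq n a v + (\<Sum>i<n. cnj (?e i) * (\<Sum>j<n. a i j * v j))
      + (\<Sum>j<n. ?e j * (\<Sum>i<n. cnj (v i) * a i j)) + (\<Sum>i<n. \<Sum>j<n. cnj (?e i) * a i j * ?e j)"
    unfolding sesq_def sum_distrib_left
    by (simp only: sum.distrib[symmetric] complex_cnj_add ring_distribs mult_ac add_ac)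
  moreover have "(\<Sum>i<n. cnj (?e i) * (\<Sum>j<n. a i j * v j)) = cnj t * L"
    using p by (simp add: if_distrib[of cnj] if_distribR if_distrib[of "\<lambda>x. x * _"] L_def cong: if_cong)
  moreover have "(\<Sum>j<n. ?e j * (\<Sum>i<n. cnj (v i) * a i j)) = t * (\<Sum>i<n. cnj (v i) * a i p)"
    using p by (simp add: if_distrib[of "\<lambda>x. x * _"] cong: if_cong)
  moreover have "(\<Sum>i<n. cnj (v i) * a i p) = cnj L"
    unfolding L_def using p by (auto simp: herm[of p] intro!: sum.cong)
  moreover have "(\<Sum>i<n. \<Sum>j<n. cnj (?e i) * a i j * ?e j) = t * cnj t * a p p"
    using p by (simp add: if_distrib[of cnj] if_distrib[of "\<lambda>x. x * _"] if_distrib[of "\<lambda>x. _ * x"] cong: if_cong)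
  ultimately show ?thesis by simp
qed

lemma sesq_gram_sum:
  "sesq n (\<lambda>i j. \<Sum>m\<in>K. w m i * cnj (w m j)) v = of_real (\<Sum>m\<in>K. (cmod (\<Sum>i<n. cnj (v i) * w m i))\<^sup>2)"
proof -
  have "sesq n (\<lambda>i j. \<Sum>m\<in>K. w m i * cnj (w m j)) v
      = (\<Sum>m\<in>K. \<Sum>i<n. \<Sum>j<n. (cnj (v i) * w m i) * cnj (cnj (v j) * w m j))"
    unfolding sesq_def sum_distrib_left sum_distrib_right
    by (subst (2) sum.swap, subst (3) sum.swap) (simp only: mult_ac complex_cnj_mult complex_cnj_cnj)
  also have "\<dots> = (\<Sum>m\<in>K. (\<Sum>i<n. cnj (v i) * w m i) * cnj (\<Sum>i<n. cnj (v i) * w m i))"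
    unfolding cnj_sum sum_product ..
  finally show ?thesis by (simp only: of_real_sum complex_norm_square)
qed

text \<open>The proof removes a rank-one Hermitian matrix that clears the first nonzero row and column,
  so \<open>k\<close> counts the trailing rows that are not yet cleared.\<close>

lemma cholesky_aux:
  assumes "k \<le> n"
    and "\<And>i j. i < n \<Longrightarrow> j < n \<Longrightarrow> a j i = cnj (a i j)"
    and "\<And>v. 0 \<le> Re (sesq n a v)"
    and "\<And>i j. i < n \<Longrightarrow> j < n \<Longrightarrow> i < n - k \<or> j < n - k \<Longrightarrow> a i j = 0"
  shows "\<exists>w. \<forall>i<n. \<forall>j<n. a i j = (\<Sum>m<k. w m i * cnj (w m j))"
  using assms
proof (induction k arbitrary: a)
  case 0
  then show ?case by simp
next
  case (Suc k)
  note herm = Suc.prems(2) and pos = Suc.prems(3) and zero = Suc.prems(4)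
  define p where "p = n - Suc k"
  have p: "p < n" "n - k = Suc p" using Suc.prems(1) by (auto simp: p_def)
  define c where "c = Re (a p p)"
  have app: "a p p = of_real c"
    using herm[OF p(1) p(1)] unfolding c_def by (simp add: complex_eq_iff)
  have shift: "Re (sesq n a (\<lambda>i. v i + (if i = p then t else 0))) =
      Re (sesq n a v) + 2 * Re (cnj t * (\<Sum>j<n. a p j * v j)) + (cmod t)\<^sup>2 * c" for v t
  proof -
    have "sesq n a (\<lambda>i. v i + (if i = p then t else 0)) =
      sesq n a v + cnj t * (\<Sum>j<n. a p j * v j) + t * cnj (\<Sum>j<n. a p j * v j) + t * cnj t * a p p"
      by (rule sesq_shift[OF herm p(1)])
    moreover have "t * cnj t * a p p = of_real ((cmod t)\<^sup>2 * c)"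
      by (simp only: app of_real_mult complex_norm_square)
    ultimately show ?thesis by (simp del: cnj_sum)
  qed
  have "sesq n a (\<lambda>i. 0) = 0" by (simp add: sesq_def)
  then have "0 \<le> c" using pos[of "\<lambda>i. 0 + (if i = p then 1 else 0)"] unfolding shift by simp
  show ?case
  proof (cases "c = 0")
    case True
    have row: "a p j = 0" if "j < n" for j
    proof (rule ccontr)
      assume nz: "a p j \<noteq> 0"
      define e where "e = (\<lambda>i. if i = j then 1 else 0 :: complex)"
      have L: "(\<Sum>m<n. a p m * e m) = a p j"
        using that by (simp add: e_def if_distrib[of "\<lambda>x. _ * x"] cong: if_cong)
      \<comment> \<open>With \<open>c = 0\<close> the quadratic term vanishes, so the form along
        this direction is affine in \<open>s\<close> with slope
        \<open>- 2 * (cmod (a p j))\<^sup>2\<close>; this value of \<open>s\<close> makes it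
        negative.\<close>
      define s where "s = (\<bar>Re (sesq n a e)\<bar> + 1) / (cmod (a p j))\<^sup>2"
      have "0 \<le> Re (sesq n a e) + 2 * Re (cnj (- of_real s * a p j) * a p j)"
        using pos[of "\<lambda>i. e i + (if i = p then - of_real s * a p j else 0)"] True unfolding shift L by simp
      also have "cnj (- of_real s * a p j) * a p j = of_real (- s * (cmod (a p j))\<^sup>2)"
        unfolding of_real_mult complex_norm_square by (simp add: algebra_simps)
      also have "- s * (cmod (a p j))\<^sup>2 = - (\<bar>Re (sesq n a e)\<bar> + 1)"
        using nz by (simp add: s_def)
      finally show False by simp
    qed
    have "\<exists>w. \<forall>i<n. \<forall>j<n. a i j = (\<Sum>m<k. w m i * cnj (w m j))"
    proof (rule Suc.IH)
      fix i j assume ij: "i < n" "j < n" "i < n - k \<or> j < n - k"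
      then consider "i < n - Suc k \<or> j < n - Suc k" | "i = p" | "j = p"
        unfolding p(2) p_def[symmetric] less_Suc_eq by blast
      then show "a i j = 0"
        using zero[OF ij(1,2)] row ij herm[of p i] p by cases auto
    qed (use Suc.prems(1) in simp, rule herm, assumption+, rule pos)
    then obtain w where w: "\<forall>i<n. \<forall>j<n. a i j = (\<Sum>m<k. w m i * cnj (w m j))" by blast
    then show ?thesis by (intro exI[of _ "w(k := \<lambda>_. 0)"]) simp
  next
    case False
    then have c: "c > 0" using \<open>0 \<le> c\<close> by simp
    \<comment> \<open>Column \<open>p\<close> scaled to have diagonal entry \<open>sqrt c\<close>,
      so that subtracting \<open>b i * cnj (b j)\<close> clears row and column \<open>p\<close>
      exactly.\<close>
    define b where "b = (\<lambda>i. a i p / of_real (sqrt c))"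
    define a' where "a' = (\<lambda>i j. a i j - b i * cnj (b j))"
    have sc: "complex_of_real (sqrt c) * of_real (sqrt c) = of_real c"
      using c by (simp flip: of_real_mult)
    have bb: "b i * cnj (b j) = a i p * a p j / of_real c" if "i < n" "j < n" for i j
      using herm[OF that(2) p(1)] by (simp add: b_def sc)
    have "\<exists>w. \<forall>i<n. \<forall>j<n. a' i j = (\<Sum>m<k. w m i * cnj (w m j))"
    proof (rule Suc.IH)
      show "a' j i = cnj (a' i j)" if "i < n" "j < n" for i j
        using herm[OF that] by (simp add: a'_def)
      show "0 \<le> Re (sesq n a' v)" for v
      proof -
        define L where "L = (\<Sum>j<n. a p j * v j)"
        have "sesq n a' v = sesq n a v - sesq n (\<lambda>i j. \<Sum>m\<in>{0::nat}. b i * cnj (b j)) v"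
          unfolding a'_def sesq_def by (simp add: algebra_simps sum_subtractf)
        also have "sesq n (\<lambda>i j. \<Sum>m\<in>{0::nat}. b i * cnj (b j)) v = of_real ((cmod (\<Sum>i<n. cnj (v i) * b i))\<^sup>2)"
          using sesq_gram_sum[where K = "{0::nat}" and w = "\<lambda>_. b"] by simp
        also have "(\<Sum>i<n. cnj (v i) * b i) = cnj L / of_real (sqrt c)"
          unfolding L_def b_def cnj_sum sum_divide_distrib
          using p herm[of p] by (intro sum.cong) auto
        also have "(cmod (cnj L / of_real (sqrt c)))\<^sup>2 = (cmod L)\<^sup>2 / c"
          using c by (simp add: norm_divide power_divide)
        finally have 1: "Re (sesq n a' v) = Re (sesq n a v) - (cmod L)\<^sup>2 / c" by simp
        \<comment> \<open>\<open>t = - L / c\<close> minimizes the quadratic in \<open>t\<close>,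
          and the minimum is the value at \<open>v\<close> of the form of the Schur complement
          \<open>a'\<close>.\<close>
        have "0 \<le> Re (sesq n a v) + 2 * Re (cnj (- L / of_real c) * L) + (cmod (- L / of_real c))\<^sup>2 * c"
          using pos[of "\<lambda>i. v i + (if i = p then - L / of_real c else 0)"] unfolding shift L_def[symmetric] .
        also have "cnj (- L / of_real c) * L = of_real (- (cmod L)\<^sup>2 / c)"
          unfolding of_real_divide of_real_minus complex_norm_square by (simp add: mult.commute)
        also have "(cmod (- L / of_real c))\<^sup>2 * c = (cmod L)\<^sup>2 / c"
          using c by (simp add: norm_divide power_divide power2_eq_square)
        finally show ?thesis unfolding 1 by simp
      qed
      fix i j assume ij: "i < n" "j < n" "i < n - k \<or> j < n - k"
      then consider "i < n - Suc k \<or> j < n - Suc k" | "i = p" | "j = p"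
        unfolding p(2) p_def[symmetric] less_Suc_eq by blast
      then show "a' i j = 0"
      proof cases
        case 1
        then have "a i p = 0 \<or> a p j = 0" "a i j = 0"
          using zero[OF ij(1) p(1)] zero[OF p(1) ij(2)] zero[OF ij(1,2)] by auto
        then show ?thesis using bb[OF ij(1,2)] by (auto simp: a'_def)
      qed (use bb[OF ij(1,2)] c in \<open>auto simp: a'_def app\<close>)
    qed (use Suc.prems(1) in simp)
    then obtain w where w: "\<forall>i<n. \<forall>j<n. a' i j = (\<Sum>m<k. w m i * cnj (w m j))" by blast
    have "a i j = (\<Sum>m<Suc k. (w(k := b)) m i * cnj ((w(k := b)) m j))" if "i < n" "j < n" for i j
      using w[rule_format, OF that] by (simp add: a'_def algebra_simps)
    then show ?thesis by blast
  qed
qed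

lemma psd_iff_sesq:
  "psd n A \<longleftrightarrow> A \<in> carrier_mat n n \<and> (\<forall>i<n. \<forall>j<n. cnj (A $$ (i,j)) = A $$ (j,i))
     \<and> (\<forall>v. 0 \<le> Re (sesq n (\<lambda>i j. A $$ (i,j)) v))"
proof (cases "A \<in> carrier_mat n n")
  case A: True
  have adj: "adj_mat A = A \<longleftrightarrow> (\<forall>i<n. \<forall>j<n. cnj (A $$ (i,j)) = A $$ (j,i))"
    using A by (auto simp: adj_mat_def mat_eq_iff)
  have form: "conjugate v \<bullet> (A *\<^sub>v v) = sesq n (\<lambda>i j. A $$ (i,j)) (\<lambda>i. vec_index v i)"
    if "v \<in> carrier_vec n" for v
    using A that
    by (auto simp: scalar_prod_def sesq_def sum_distrib_left mult.assoc atLeast0LessThan intro!: sum.cong)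
  have im: "Im (sesq n (\<lambda>i j. A $$ (i,j)) v) = 0" if h: "\<forall>i<n. \<forall>j<n. cnj (A $$ (i,j)) = A $$ (j,i)" for v
  proof -
    have "cnj (sesq n (\<lambda>i j. A $$ (i,j)) v) = (\<Sum>i<n. \<Sum>j<n. cnj (v j) * A $$ (j,i) * v i)"
      unfolding sesq_def cnj_sum using h by (auto intro!: sum.cong simp: mult_ac)
    also have "\<dots> = sesq n (\<lambda>i j. A $$ (i,j)) v"
      unfolding sesq_def by (rule sum.swap)
    finally show ?thesis by (simp add: complex_eq_iff)
  qed
  have vec: "sesq n a (\<lambda>i. vec_index (vec n v) i) = sesq n a v" for a v
    by (simp add: sesq_def)
  show ?thesis
  proof (intro iffI conjI)
    assume psd: "psd n A"
    then show "A \<in> carrier_mat n n" "\<forall>i<n. \<forall>j<n. cnj (A $$ (i,j)) = A $$ (j,i)"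
      using adj unfolding psd_def by metis+
    show "\<forall>v. 0 \<le> Re (sesq n (\<lambda>i j. A $$ (i,j)) v)"
      using psd form[OF vec_carrier] unfolding psd_def by (metis vec vec_carrier)
  next
    assume "A \<in> carrier_mat n n \<and> (\<forall>i<n. \<forall>j<n. cnj (A $$ (i,j)) = A $$ (j,i))
      \<and> (\<forall>v. 0 \<le> Re (sesq n (\<lambda>i j. A $$ (i,j)) v))"
    then show "psd n A"
      unfolding psd_def using adj im form by metis
  qed
qed (simp add: psd_def)

text \<open>Cholesky factorization: for \<open>k = n\<close> the hypothesis of
  \<open>cholesky_aux\<close> on cleared rows is vacuous.\<close>

lemma psd_gram:
  assumes "psd n A"
  obtains w where "\<And>i j. i < n \<Longrightarrow> j < n \<Longrightarrow> A $$ (i,j) = (\<Sum>m<n. w m i * cnj (w m j))"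
proof -
  have "\<exists>w. \<forall>i<n. \<forall>j<n. A $$ (i,j) = (\<Sum>m<n. w m i * cnj (w m j))"
    by (rule cholesky_aux) (use assms in \<open>simp_all add: psd_iff_sesq\<close>)
  then show thesis using that by blast
qed

lemma psd_of_gram:
  assumes "A \<in> carrier_mat n n"
    and "\<And>i j. i < n \<Longrightarrow> j < n \<Longrightarrow> A $$ (i,j) = (\<Sum>m\<in>K. w m i * cnj (w m j))"
  shows "psd n A"
proof -
  have "sesq n (\<lambda>i j. A $$ (i,j)) v = sesq n (\<lambda>i j. \<Sum>m\<in>K. w m i * cnj (w m j)) v" for v
    unfolding sesq_def using assms(2) by simp
  then show ?thesis
    unfolding psd_iff_sesq sesq_gram_sum using assms by (simp add: sum_nonneg mult.commute)
qed

lemma mtrace_mult: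
  assumes "A \<in> carrier_mat n n" "B \<in> carrier_mat n n"
  shows "mtrace (A * B) = (\<Sum>i<n. \<Sum>j<n. A $$ (i,j) * B $$ (j,i))"
  using assms by (auto simp: mtrace_def scalar_prod_def atLeast0LessThan intro!: sum.cong)

text \<open>With \<open>A\<close> a sum of rank-one terms, the trace is the sum of the values of the
  form of \<open>B\<close> at the vectors \<open>w m\<close>. Factoring \<open>B\<close> as well
  turns each value into a sum of squares, which gives reality and sign at once.\<close>

lemma mtrace_psd_mult:
  assumes "psd n A" "psd n B"
  obtains r where "0 \<le> r" "mtrace (A * B) = of_real r"
proof -
  obtain w where w: "\<And>i j. i < n \<Longrightarrow> j < n \<Longrightarrow> A $$ (i,j) = (\<Sum>m<n. w m i * cnj (w m j))"
    using psd_gram[OF assms(1)] by blast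
  obtain u where u: "\<And>i j. i < n \<Longrightarrow> j < n \<Longrightarrow> B $$ (i,j) = (\<Sum>m<n. u m i * cnj (u m j))"
    using psd_gram[OF assms(2)] by blast
  have "mtrace (A * B) = (\<Sum>i<n. \<Sum>j<n. (\<Sum>m<n. w m i * cnj (w m j)) * B $$ (j,i))"
    using assms w by (subst mtrace_mult) (auto simp: psd_def)
  also have "\<dots> = (\<Sum>m<n. sesq n (\<lambda>i j. B $$ (i,j)) (w m))"
    unfolding sesq_def sum_distrib_right
    apply (subst (2) sum.swap, subst sum.swap, subst (2) sum.swap)
    by (simp add: mult_ac)
  also have "\<dots> = (\<Sum>m<n. sesq n (\<lambda>i j. \<Sum>m<n. u m i * cnj (u m j)) (w m))"
    unfolding sesq_def using u by simp
  finally have "mtrace (A * B) = of_real (\<Sum>m<n. \<Sum>k<n. (cmod (\<Sum>i<n. cnj (w m i) * u k i))\<^sup>2)"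
    unfolding sesq_gram_sum of_real_sum .
  then show thesis
    by (rule that[rotated]) (intro sum_nonneg zero_le_power2)
qed

subsection \<open>Tensor products\<close>

lemma psd_carrier: "psd n A \<Longrightarrow> A \<in> carrier_mat n n"
  by (simp add: psd_def)

lemma psd_one: "psd n (1\<^sub>m n)"
  by (rule psd_of_gram[where K = "{..<n}" and w = "\<lambda>m i. if m = i then 1 else 0"])
    (simp_all add: if_distrib[of cnj] if_distrib[of "\<lambda>x. x * _"] cong: if_cong)

lemma sum_div_mod:
  fixes f :: "nat \<Rightarrow> nat \<Rightarrow> 'a::comm_monoid_add"
  shows "(\<Sum>i<n * m. f (i div m) (i mod m)) = (\<Sum>a<n. \<Sum>b<m. f a b)"
proof (cases "m = 0")
  case False
  have "(\<Sum>i<n * m. f (i div m) (i mod m)) = (\<Sum>p\<in>{..<n} \<times> {..<m}. f (fst p) (snd p))"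
  proof (rule sum.reindex_bij_witness[of _ "\<lambda>p. fst p * m + snd p" "\<lambda>i. (i div m, i mod m)"])
    fix p assume p: "p \<in> {..<n} \<times> {..<m}"
    then have "fst p * m + snd p < (fst p + 1) * m"
      by auto
    moreover have "(fst p + 1) * m \<le> n * m"
      using p by (intro mult_le_mono1) auto
    ultimately
    show "fst p * m + snd p \<in> {..<n * m}" by simp
  qed (use False in \<open>auto simp: less_mult_imp_div_less\<close>)
  then show ?thesis by (simp add: sum.cartesian_product split_beta)
qed simp

lemma kron_carrier:
  "A \<in> carrier_mat n n \<Longrightarrow> B \<in> carrier_mat m m \<Longrightarrow> kron A B \<in> carrier_mat (n * m) (n * m)"
  by (auto simp: kron_def)

lemma kron_index:
  assumes "A \<in> carrier_mat n n" "B \<in> carrier_mat m m" "i < n * m" "j < n * m"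
  shows "kron A B $$ (i,j) = A $$ (i div m, j div m) * B $$ (i mod m, j mod m)"
  using assms by (auto simp: kron_def)

lemma div_mod_less:
  fixes i n m :: nat
  assumes "i < n * m"
  shows "i div m < n" "i mod m < m"
  using assms less_mult_imp_div_less[of i n m] by (cases "m = 0"; simp)+

lemma mtrace_kron:
  assumes "A \<in> carrier_mat n n" "B \<in> carrier_mat m m"
  shows "mtrace (kron A B) = mtrace A * mtrace B"
proof -
  have "mtrace (kron A B) = (\<Sum>i<n * m. A $$ (i div m, i div m) * B $$ (i mod m, i mod m))"
    using kron_carrier[OF assms] kron_index[OF assms] by (auto simp: mtrace_def)
  also have "\<dots> = mtrace A * mtrace B"
    unfolding sum_div_mod[of "\<lambda>a b. A $$ (a,a) * B $$ (b,b)"]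
    using assms by (simp add: mtrace_def sum_product)
  finally show ?thesis .
qed

lemma mtrace_kron_mult:
  assumes A: "A \<in> carrier_mat n n" "C \<in> carrier_mat n n"
    and B: "B \<in> carrier_mat m m" "D \<in> carrier_mat m m"
  shows "mtrace (kron A B * kron C D) = mtrace (A * C) * mtrace (B * D)"
proof -
  have "mtrace (kron A B * kron C D) = (\<Sum>i<n * m. \<Sum>j<n * m.
      (A $$ (i div m, j div m) * C $$ (j div m, i div m)) * (B $$ (i mod m, j mod m) * D $$ (j mod m, i mod m)))"
    unfolding mtrace_mult[OF kron_carrier[OF A(1) B(1)] kron_carrier[OF A(2) B(2)]]
    by (intro sum.cong refl) (simp add: kron_index[OF A(1) B(1)] kron_index[OF A(2) B(2)])
  also have "\<dots> = (\<Sum>a<n. \<Sum>b<m. \<Sum>a'<n. \<Sum>b'<m.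
      (A $$ (a, a') * C $$ (a', a)) * (B $$ (b, b') * D $$ (b', b)))"
    unfolding sum_div_mod[of "\<lambda>a b. \<Sum>j<n * m. (A $$ (a, j div m) * C $$ (j div m, a)) * (B $$ (b, j mod m) * D $$ (j mod m, b))"]
    by (intro sum.cong refl sum_div_mod)
  also have "\<dots> = mtrace (A * C) * mtrace (B * D)"
    unfolding mtrace_mult[OF A] mtrace_mult[OF B] by (simp only: sum_product)
  finally show ?thesis .
qed

text \<open>The products of Gram vectors of the two factors are Gram vectors of
  \<open>kron A B\<close>.\<close>

lemma psd_kron:
  assumes A: "psd n A" and B: "psd m B"
  shows "psd (n * m) (kron A B)"
proof -
  obtain w where w: "\<And>i j. i < n \<Longrightarrow> j < n \<Longrightarrow> A $$ (i,j) = (\<Sum>k<n. w k i * cnj (w k j))"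
    using psd_gram[OF A] by blast
  obtain u where u: "\<And>i j. i < m \<Longrightarrow> j < m \<Longrightarrow> B $$ (i,j) = (\<Sum>k<m. u k i * cnj (u k j))"
    using psd_gram[OF B] by blast
  show ?thesis
  proof (rule psd_of_gram)
    fix i j assume ij: "i < n * m" "j < n * m"
    show "kron A B $$ (i,j) = (\<Sum>p\<in>{..<n} \<times> {..<m}.
        (w (fst p) (i div m) * u (snd p) (i mod m)) * cnj (w (fst p) (j div m) * u (snd p) (j mod m)))"
      unfolding kron_index[OF psd_carrier[OF A] psd_carrier[OF B] ij]
        w[OF div_mod_less(1)[OF ij(1)] div_mod_less(1)[OF ij(2)]]
        u[OF div_mod_less(2)[OF ij(1)] div_mod_less(2)[OF ij(2)]]
      by (simp add: sum_product sum.cartesian_product split_beta mult.assoc mult.left_commute)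
  qed (intro kron_carrier psd_carrier A B)
qed

section \<open>Tensor products of a sequence of matrices\<close>

lemma tensor_seq_0 [simp]: "tensor_seq 0 F = 1\<^sub>m 1"
  by (simp add: tensor_seq_def)

lemma tensor_seq_Suc: "tensor_seq (Suc l) F = kron (F 0) (tensor_seq l (\<lambda>k. F (Suc k)))"
  by (simp add: tensor_seq_def upt_conv_Cons map_Suc_upt[symmetric] comp_def del: upt_Suc)

lemma tensor_seq_carrier:
  "(\<And>k. k < l \<Longrightarrow> F k \<in> carrier_mat d d) \<Longrightarrow> tensor_seq l F \<in> carrier_mat (d ^ l) (d ^ l)"
  by (induction l arbitrary: F) (auto simp: tensor_seq_Suc intro!: kron_carrier)

lemma psd_tensor_seq:
  "(\<And>k. k < l \<Longrightarrow> psd d (F k)) \<Longrightarrow> psd (d ^ l) (tensor_seq l F)"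
  by (induction l arbitrary: F) (auto simp: tensor_seq_Suc intro!: psd_kron psd_one[of 1, simplified])

lemma mtrace_tensor_seq:
  "(\<And>k. k < l \<Longrightarrow> F k \<in> carrier_mat d d) \<Longrightarrow> mtrace (tensor_seq l F) = (\<Prod>k<l. mtrace (F k))"
proof (induction l arbitrary: F)
  case (Suc l)
  then show ?case
    by (simp add: tensor_seq_Suc mtrace_kron[OF _ tensor_seq_carrier[of l _ d], of _ d] prod.lessThan_Suc_shift
        del: prod.lessThan_Suc)
qed (simp add: mtrace_def)

lemma mtrace_tensor_seq_mult:
  assumes "\<And>k. k < l \<Longrightarrow> F k \<in> carrier_mat d d" "\<And>k. k < l \<Longrightarrow> G k \<in> carrier_mat d d"
  shows "mtrace (tensor_seq l F * tensor_seq l G) = (\<Prod>k<l. mtrace (F k * G k))"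
  using assms
proof (induction l arbitrary: F G)
  case (Suc l)
  have "mtrace (tensor_seq (Suc l) F * tensor_seq (Suc l) G) = mtrace (F 0 * G 0) *
      mtrace (tensor_seq l (\<lambda>k. F (Suc k)) * tensor_seq l (\<lambda>k. G (Suc k)))"
    unfolding tensor_seq_Suc using Suc.prems
    by (intro mtrace_kron_mult[of _ d _ _ "d ^ l"] tensor_seq_carrier) auto
  also have "mtrace (tensor_seq l (\<lambda>k. F (Suc k)) * tensor_seq l (\<lambda>k. G (Suc k)))
      = (\<Prod>k<l. mtrace (F (Suc k) * G (Suc k)))"
    using Suc.prems by (intro Suc.IH) auto
  finally show ?case by (simp add: prod.lessThan_Suc_shift del: prod.lessThan_Suc)
qed (simp add: mtrace_def)

lemma tensor_seq_one: "tensor_seq l (\<lambda>_. 1\<^sub>m d) = 1\<^sub>m (d ^ l)"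
proof (induction l)
  case (Suc l)
  have "kron (1\<^sub>m d) (1\<^sub>m (d ^ l)) = 1\<^sub>m (d * d ^ l)"
  proof (rule eq_matI)
    fix i j assume "i < dim_row (1\<^sub>m (d * d ^ l))" "j < dim_col (1\<^sub>m (d * d ^ l))"
    then have ij: "i < d * d ^ l" "j < d * d ^ l" by simp_all
    have "i = j \<longleftrightarrow> i div d ^ l = j div d ^ l \<and> i mod d ^ l = j mod d ^ l"
      by (metis div_mult_mod_eq)
    then show "kron (1\<^sub>m d) (1\<^sub>m (d ^ l)) $$ (i, j) = 1\<^sub>m (d * d ^ l) $$ (i, j)"
      using ij div_mod_less[OF ij(1)] div_mod_less[OF ij(2)]
      by (subst kron_index[OF one_carrier_mat one_carrier_mat ij]) auto
  qed (auto simp: kron_def)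
  then show ?case by (simp add: tensor_seq_Suc Suc.IH)
qed simp

text \<open>For \<open>i < d ^ l\<close> this is the \<open>k\<close>-th of the \<open>l\<close>
  base-\<open>d\<close> digits of \<open>i\<close>, the most significant one first: the order in
  which \<open>foldr kron\<close> nests the factors.\<close>

fun digit :: "nat \<Rightarrow> nat \<Rightarrow> nat \<Rightarrow> nat \<Rightarrow> nat" where
  "digit d 0 k i = 0"
| "digit d (Suc l) 0 i = i div d ^ l"
| "digit d (Suc l) (Suc k) i = digit d l k (i mod d ^ l)"

lemma digit_less: "k < l \<Longrightarrow> i < d ^ l \<Longrightarrow> digit d l k i < d"
proof (induction d l k i rule: digit.induct)
  case (2 d l i)
  then show ?case using div_mod_less(1)[of i d "d ^ l"] by simp
next
  case (3 d l k i)
  then show ?case using div_mod_less(2)[of i d "d ^ l"] by simp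
qed simp

lemma tensor_seq_index:
  assumes "\<And>k. k < l \<Longrightarrow> F k \<in> carrier_mat d d" "i < d ^ l" "j < d ^ l"
  shows "tensor_seq l F $$ (i,j) = (\<Prod>k<l. F k $$ (digit d l k i, digit d l k j))"
  using assms
proof (induction l arbitrary: F i j)
  case (Suc l)
  have ij: "i < d * d ^ l" "j < d * d ^ l" using Suc.prems by simp_all
  have "tensor_seq (Suc l) F $$ (i,j) = F 0 $$ (i div d ^ l, j div d ^ l) *
      tensor_seq l (\<lambda>k. F (Suc k)) $$ (i mod d ^ l, j mod d ^ l)"
    unfolding tensor_seq_Suc using Suc.prems by (intro kron_index tensor_seq_carrier) auto
  also have "tensor_seq l (\<lambda>k. F (Suc k)) $$ (i mod d ^ l, j mod d ^ l)
      = (\<Prod>k<l. F (Suc k) $$ (digit d l k (i mod d ^ l), digit d l k (j mod d ^ l)))"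
    using Suc.prems(1) div_mod_less(2)[OF ij(1)] div_mod_less(2)[OF ij(2)] by (intro Suc.IH) auto
  finally show ?case by (simp add: prod.lessThan_Suc_shift del: prod.lessThan_Suc)
qed simp

text \<open>Multilinearity, reduced entrywise to expanding a product of scalar sums. It serves
  twice: with the jammer's weights, to expand a product of mixtures over pure jamming sequences, and
  with weights 1, to expand the identity over all outcome words of a product measurement.\<close>

lemma tensor_seq_sum_index:
  fixes c :: "nat \<Rightarrow> 'b \<Rightarrow> complex"
  assumes "\<And>k. k < l \<Longrightarrow> F k \<in> carrier_mat d d"
    and G: "\<And>k s. k < l \<Longrightarrow> s \<in> B \<Longrightarrow> G k s \<in> carrier_mat d d"
    and "finite B"
    and F: "\<And>k a b. k < l \<Longrightarrow> a < d \<Longrightarrow> b < d \<Longrightarrow> F k $$ (a,b) = (\<Sum>s\<in>B. c k s * G k s $$ (a,b))"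
    and ij: "i < d ^ l" "j < d ^ l"
  shows "tensor_seq l F $$ (i,j)
    = (\<Sum>s\<in>{..<l} \<rightarrow>\<^sub>E B. (\<Prod>k<l. c k (s k)) * tensor_seq l (\<lambda>k. G k (s k)) $$ (i,j))"
proof -
  have "tensor_seq l F $$ (i,j) = (\<Prod>k<l. F k $$ (digit d l k i, digit d l k j))"
    using assms(1) ij by (rule tensor_seq_index)
  also have "\<dots> = (\<Prod>k<l. \<Sum>s\<in>B. c k s * G k s $$ (digit d l k i, digit d l k j))"
    by (intro prod.cong refl F digit_less ij) auto
  also have "\<dots> = (\<Sum>s\<in>{..<l} \<rightarrow>\<^sub>E B. \<Prod>k<l. c k (s k) * G k (s k) $$ (digit d l k i, digit d l k j))"
    using \<open>finite B\<close> by (intro prod_sum_PiE) auto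
  also have "\<dots> = (\<Sum>s\<in>{..<l} \<rightarrow>\<^sub>E B. (\<Prod>k<l. c k (s k)) * tensor_seq l (\<lambda>k. G k (s k)) $$ (i,j))"
  proof (intro sum.cong refl)
    fix s assume "s \<in> {..<l} \<rightarrow>\<^sub>E B"
    then have "tensor_seq l (\<lambda>k. G k (s k)) $$ (i,j) = (\<Prod>k<l. G k (s k) $$ (digit d l k i, digit d l k j))"
      by (intro tensor_seq_index G ij) auto
    then show "(\<Prod>k<l. c k (s k) * G k (s k) $$ (digit d l k i, digit d l k j))
        = (\<Prod>k<l. c k (s k)) * tensor_seq l (\<lambda>k. G k (s k)) $$ (i,j)"
      by (simp add: prod.distrib)
  qed
  finally show ?thesis .
qed

lemma mtrace_tensor_seq_sum_mult:
  fixes c :: "nat \<Rightarrow> 'b \<Rightarrow> complex"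
  assumes F: "\<And>k. k < l \<Longrightarrow> F k \<in> carrier_mat d d"
    and G: "\<And>k s. k < l \<Longrightarrow> s \<in> B \<Longrightarrow> G k s \<in> carrier_mat d d"
    and "finite B"
    and "\<And>k a b. k < l \<Longrightarrow> a < d \<Longrightarrow> b < d \<Longrightarrow> F k $$ (a,b) = (\<Sum>s\<in>B. c k s * G k s $$ (a,b))"
    and Y: "Y \<in> carrier_mat (d ^ l) (d ^ l)"
  shows "mtrace (tensor_seq l F * Y)
    = (\<Sum>s\<in>{..<l} \<rightarrow>\<^sub>E B. (\<Prod>k<l. c k (s k)) * mtrace (tensor_seq l (\<lambda>k. G k (s k)) * Y))"
proof -
  have tc: "tensor_seq l F \<in> carrier_mat (d ^ l) (d ^ l)"
    using F by (rule tensor_seq_carrier)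
  have "mtrace (tensor_seq l F * Y) = (\<Sum>i<d ^ l. \<Sum>j<d ^ l. \<Sum>s\<in>{..<l} \<rightarrow>\<^sub>E B.
      (\<Prod>k<l. c k (s k)) * (tensor_seq l (\<lambda>k. G k (s k)) $$ (i,j) * Y $$ (j,i)))"
    unfolding mtrace_mult[OF tc Y]
  proof (intro sum.cong refl)
    fix i j assume "i \<in> {..<d ^ l}" "j \<in> {..<d ^ l}"
    then have "tensor_seq l F $$ (i,j)
      = (\<Sum>s\<in>{..<l} \<rightarrow>\<^sub>E B. (\<Prod>k<l. c k (s k)) * tensor_seq l (\<lambda>k. G k (s k)) $$ (i,j))"
      using assms by (intro tensor_seq_sum_index) auto
    then show "tensor_seq l F $$ (i,j) * Y $$ (j,i) = (\<Sum>s\<in>{..<l} \<rightarrow>\<^sub>E B.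
      (\<Prod>k<l. c k (s k)) * (tensor_seq l (\<lambda>k. G k (s k)) $$ (i,j) * Y $$ (j,i)))"
      by (simp only: sum_distrib_right mult.assoc)
  qed
  also have "\<dots> = (\<Sum>s\<in>{..<l} \<rightarrow>\<^sub>E B. (\<Prod>k<l. c k (s k)) *
      (\<Sum>i<d ^ l. \<Sum>j<d ^ l. tensor_seq l (\<lambda>k. G k (s k)) $$ (i,j) * Y $$ (j,i)))"
    unfolding sum_distrib_left by (subst (2) sum.swap, subst sum.swap) (rule refl)
  also have "\<dots> = (\<Sum>s\<in>{..<l} \<rightarrow>\<^sub>E B. (\<Prod>k<l. c k (s k)) * mtrace (tensor_seq l (\<lambda>k. G k (s k)) * Y))"
    by (intro sum.cong refl arg_cong2[where f = "(*)"] mtrace_mult[symmetric] tensor_seq_carrier Y G) auto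
  finally show ?thesis .
qed

subsection \<open>Nearest-codeword decoding of binary words\<close>

abbreviation words :: "nat \<Rightarrow> (nat \<Rightarrow> bool) set" where
  "words l \<equiv> {..<l} \<rightarrow>\<^sub>E UNIV"

text \<open>This is \<open>u\<close> to the power of the Hamming distance of \<open>a\<close> and \<open>b\<close>.\<close>

definition hweight :: "real \<Rightarrow> nat \<Rightarrow> (nat \<Rightarrow> bool) \<Rightarrow> (nat \<Rightarrow> bool) \<Rightarrow> real" where
  "hweight u l a b = (\<Prod>k<l. if a k = b k then 1 else u)"

lemma hweight_commute: "hweight u l a b = hweight u l b a"
  unfolding hweight_def by (intro prod.cong) auto

lemma hweight_pos: "0 < u \<Longrightarrow> 0 < hweight u l a b"
  unfolding hweight_def by (intro prod_pos) auto

lemma sum_words_prod: "(\<Sum>y\<in>words l. \<Prod>k<l. f k (y k)) = (\<Prod>k<l. f k True + f k False)"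
  for f :: "nat \<Rightarrow> bool \<Rightarrow> 'a::comm_semiring_1"
  by (simp add: prod_sum_PiE[symmetric] UNIV_bool add.commute)

text \<open>Greedy choice: every codeword chosen so far excludes at most \<open>(\<theta> * 2) ^ l\<close> of the
  \<open>2 ^ l\<close> words, by Markov's inequality for \<^term>\<open>hweight q l (c i)\<close>.\<close>

lemma exists_code:
  fixes q \<theta> :: real
  assumes "0 < q" "0 < \<theta>" and q: "1 + q = 2 * \<theta>\<^sup>2" and "real M * \<theta> ^ l \<le> 1"
  shows "\<exists>c. \<forall>i<M. \<forall>j<M. i \<noteq> j \<longrightarrow> hweight q l (c i) (c j) \<le> \<theta> ^ l"
  using assms(4)
proof (induction M)
  case (Suc M)
  have lt: "real M * \<theta> ^ l < 1"
    using Suc.prems zero_less_power[OF \<open>0 < \<theta>\<close>, of l] unfolding of_nat_Suc distrib_right by linarith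
  then obtain c where c: "\<And>i j. i < M \<Longrightarrow> j < M \<Longrightarrow> i \<noteq> j \<Longrightarrow> hweight q l (c i) (c j) \<le> \<theta> ^ l"
    using Suc.IH by auto
  have "\<exists>w. \<forall>i<M. hweight q l (c i) w \<le> \<theta> ^ l"
  proof (rule ccontr)
    assume contra: "\<not> ?thesis"
    have "(1::real) \<le> (\<Sum>i<M. hweight q l (c i) y / \<theta> ^ l)" for y
    proof -
      obtain i where i: "i < M" "\<theta> ^ l < hweight q l (c i) y" using contra by (auto simp: not_le)
      then have "1 \<le> hweight q l (c i) y / \<theta> ^ l" using \<open>0 < \<theta>\<close> by simp
      also have "\<dots> \<le> (\<Sum>i<M. hweight q l (c i) y / \<theta> ^ l)"
        using i assms by (intro member_le_sum) (auto intro!: divide_nonneg_pos less_imp_le[OF hweight_pos])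
      finally show ?thesis .
    qed
    then have "(\<Sum>y\<in>words l. 1) \<le> (\<Sum>y\<in>words l. \<Sum>i<M. hweight q l (c i) y / \<theta> ^ l)"
      by (intro sum_mono)
    also have "\<dots> = (\<Sum>i<M. (\<Sum>y\<in>words l. hweight q l (c i) y) / \<theta> ^ l)"
      by (subst sum.swap) (simp only: sum_divide_distrib)
    also have "\<dots> = (\<Sum>i<M. (1 + q) ^ l / \<theta> ^ l)"
    proof (intro sum.cong refl arg_cong2[where f = "(/)"])
      fix i
      have "(\<Sum>y\<in>words l. hweight q l (c i) y)
          = (\<Prod>k<l. (if c i k = True then 1 else q) + (if c i k = False then 1 else q))"
        unfolding hweight_def by (rule sum_words_prod)
      also have "\<dots> = (\<Prod>k<l. 1 + q)" by (intro prod.cong) auto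
      finally show "(\<Sum>y\<in>words l. hweight q l (c i) y) = (1 + q) ^ l" by simp
    qed
    \<comment> \<open>By the choice of \<open>\<theta>\<close>,
      \<open>(1 + q) / \<theta> = 2 * \<theta>\<close>: one \<open>\<theta>\<close> acts both as the
      distance threshold and as the excluded fraction of words per position.\<close>
    also have "\<dots> = (real M * \<theta> ^ l) * 2 ^ l"
      using \<open>0 < \<theta>\<close> unfolding q by (simp add: power_mult_distrib power2_eq_square)
    also have "\<dots> < 1 * 2 ^ l"
      using lt by (intro mult_strict_right_mono) auto
    also have "\<dots> = (\<Sum>y\<in>words l. 1)" by (simp add: card_PiE)
    finally show False by simp
  qed
  then obtain w where w: "\<And>i. i < M \<Longrightarrow> hweight q l (c i) w \<le> \<theta> ^ l" by blast
  show ?case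
  proof (intro exI[of _ "c(M := w)"] allI impI)
    fix i j assume "i < Suc M" "j < Suc M" "i \<noteq> j"
    then show "hweight q l ((c(M := w)) i) ((c(M := w)) j) \<le> \<theta> ^ l"
      using c w w[of j] by (auto simp: less_Suc_eq hweight_commute[of q l w])
  qed
qed simp

text \<open>Chernoff bound: on the summation range the ratio
  \<open>hweight u l y a / hweight u l y b\<close> is at least 1, and its expectation factorizes.\<close>

lemma pairwise_error:
  fixes w :: "nat \<Rightarrow> bool \<Rightarrow> real"
  assumes w0: "\<And>k b. k < l \<Longrightarrow> 0 \<le> w k b" and w1: "\<And>k. k < l \<Longrightarrow> w k True + w k False = 1"
    and wd: "\<And>k. k < l \<Longrightarrow> w k (\<not> a k) \<le> 1 / 2 - \<delta>"
    and "1 < u" and q: "q = 1 / u + (1 / 2 - \<delta>) * (u - 1 / u)"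
  shows "(\<Sum>y | y \<in> words l \<and> hweight u l y b \<le> hweight u l y a. \<Prod>k<l. w k (y k)) \<le> hweight q l a b"
proof -
  \<comment> \<open>The weights tilted by \<open>u\<close> for a mismatch with \<open>a\<close> and
    by \<open>1 / u\<close> for a mismatch with \<open>b\<close>; where \<open>a\<close> and
    \<open>b\<close> agree the two factors cancel.\<close>
  define r where "r = (\<lambda>k y. (if y = a k then 1 else u) / (if y = b k then 1 else u) * w k y)"
  have r0: "0 \<le> r k y" if "k < l" for k y
    using that w0[of k y] \<open>1 < u\<close> by (auto simp: r_def)
  have fin: "finite (words l)" by (intro finite_PiE) auto
  have ratio: "(\<Prod>k<l. r k (y k)) = hweight u l y a / hweight u l y b * (\<Prod>k<l. w k (y k))" for y
    by (simp add: r_def hweight_def prod.distrib prod_dividef)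
  have "(\<Sum>y | y \<in> words l \<and> hweight u l y b \<le> hweight u l y a. \<Prod>k<l. w k (y k))
      \<le> (\<Sum>y | y \<in> words l \<and> hweight u l y b \<le> hweight u l y a. \<Prod>k<l. r k (y k))"
  proof (rule sum_mono)
    fix y assume "y \<in> {y. y \<in> words l \<and> hweight u l y b \<le> hweight u l y a}"
    then have "1 \<le> hweight u l y a / hweight u l y b"
      using hweight_pos[of u l y b] \<open>1 < u\<close> by simp
    moreover have "0 \<le> (\<Prod>k<l. w k (y k))" using w0 by (intro prod_nonneg) auto
    ultimately show "(\<Prod>k<l. w k (y k)) \<le> (\<Prod>k<l. r k (y k))"
      unfolding ratio using mult_right_mono by fastforce
  qed
  also have "\<dots> \<le> (\<Sum>y\<in>words l. \<Prod>k<l. r k (y k))"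
    using fin r0 by (intro sum_mono2) (auto intro!: prod_nonneg)
  also have "\<dots> = (\<Prod>k<l. r k True + r k False)" by (rule sum_words_prod)
  also have "\<dots> \<le> hweight q l a b"
    unfolding hweight_def
  proof (intro prod_mono conjI)
    fix k assume "k \<in> {..<l}"
    then have k: "k < l" by simp
    show "0 \<le> r k True + r k False" using r0[OF k] by (simp add: add_nonneg_nonneg)
    show "r k True + r k False \<le> (if a k = b k then 1 else q)"
    proof (cases "a k = b k")
      case True
      then show ?thesis using w1[OF k] \<open>1 < u\<close> by (cases "b k") (auto simp: r_def)
    next
      case False
      then have "r k True + r k False = w k (a k) / u + u * w k (\<not> a k)"
        by (cases "a k") (auto simp: r_def)
      also have "w k (a k) = 1 - w k (\<not> a k)" using w1[OF k] by (cases "a k") auto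
      \<comment> \<open>As \<open>1 / u \<le> u\<close>, this expression increases with the
        probability of the wrong bit, so it is largest at \<open>1 / 2 - \<delta>\<close>, where it
        equals \<open>q\<close>.\<close>
      also have "(1 - w k (\<not> a k)) / u + u * w k (\<not> a k) = 1 / u + w k (\<not> a k) * (u - 1 / u)"
        by (simp add: algebra_simps diff_divide_distrib)
      also have "\<dots> \<le> q"
      proof -
        have "1 / u \<le> 1" using \<open>1 < u\<close> by simp
        then have "1 / u \<le> u" using \<open>1 < u\<close> by linarith
        then show ?thesis unfolding q using wd[OF k] by (intro add_left_mono mult_right_mono) auto
      qed
      finally show ?thesis using False by simp
    qed
  qed
  finally show ?thesis .
qed

text \<open>For \<open>u > 1\<close> a smaller \<open>hweight\<close> means a smaller Hamming
  distance. The strict inequality makes the sets of different codewords disjoint; a tied word is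
  decoded to none of the tied codewords and counts as an error.\<close>

definition decoding_set :: "real \<Rightarrow> nat \<Rightarrow> nat \<Rightarrow> (nat \<Rightarrow> nat \<Rightarrow> bool) \<Rightarrow> nat \<Rightarrow> (nat \<Rightarrow> bool) set" where
  "decoding_set u l M c i =
     {y \<in> words l. \<forall>j<M. j \<noteq> i \<longrightarrow> hweight u l y (c i) < hweight u l y (c j)}"

text \<open>Union bound over the competing codewords, with \<open>pairwise_error\<close> for each of
  them. The law \<open>w k\<close> may vary with the position, as the states chosen by the jammer
  do.\<close>

lemma decoding_error:
  fixes w :: "nat \<Rightarrow> bool \<Rightarrow> real"
  assumes w0: "\<And>k b. k < l \<Longrightarrow> 0 \<le> w k b" and w1: "\<And>k. k < l \<Longrightarrow> w k True + w k False = 1"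
    and wd: "\<And>k. k < l \<Longrightarrow> w k (\<not> c i k) \<le> 1 / 2 - \<delta>"
    and "1 < u" and q: "q = 1 / u + (1 / 2 - \<delta>) * (u - 1 / u)"
    and code: "\<And>j. j < M \<Longrightarrow> j \<noteq> i \<Longrightarrow> hweight q l (c i) (c j) \<le> \<epsilon>" and "0 \<le> \<epsilon>"
  shows "(\<Sum>y\<in>words l - decoding_set u l M c i. \<Prod>k<l. w k (y k)) \<le> real M * \<epsilon>"
proof -
  let ?f = "\<lambda>y. \<Prod>k<l. w k (y k)" and ?J = "{..<M} - {i}"
  let ?P = "\<lambda>j y. hweight u l y (c j) \<le> hweight u l y (c i)"
  have fin: "finite (words l)" by (intro finite_PiE) auto
  have f0: "0 \<le> ?f y" for y using w0 by (intro prod_nonneg) auto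
  then have g0: "0 \<le> (if ?P j y then ?f y else 0)" for j y by simp
  have "(\<Sum>y\<in>words l - decoding_set u l M c i. ?f y)
      \<le> (\<Sum>y\<in>words l - decoding_set u l M c i. \<Sum>j\<in>?J. if ?P j y then ?f y else 0)"
  proof (rule sum_mono)
    fix y assume "y \<in> words l - decoding_set u l M c i"
    then obtain j where j: "j \<in> ?J" "?P j y" by (auto simp: decoding_set_def not_less)
    then have "?f y = (if ?P j y then ?f y else 0)" by simp
    also have "\<dots> \<le> (\<Sum>j\<in>?J. if ?P j y then ?f y else 0)"
      using j(1) f0 by (intro member_le_sum) auto
    finally show "?f y \<le> (\<Sum>j\<in>?J. if ?P j y then ?f y else 0)" .
  qed
  also have "\<dots> \<le> (\<Sum>y\<in>words l. \<Sum>j\<in>?J. if ?P j y then ?f y else 0)"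
    using fin by (intro sum_mono2 sum_nonneg g0) auto
  also have "\<dots> = (\<Sum>j\<in>?J. \<Sum>y | y \<in> words l \<and> ?P j y. ?f y)"
    using fin by (subst sum.swap) (simp add: sum.inter_filter)
  also have "\<dots> \<le> (\<Sum>j\<in>?J. \<epsilon>)"
  proof (rule sum_mono)
    fix j assume j: "j \<in> ?J"
    have "(\<Sum>y | y \<in> words l \<and> ?P j y. ?f y) \<le> hweight q l (c i) (c j)"
      using w0 w1 wd \<open>1 < u\<close> q by (rule pairwise_error)
    also have "\<dots> \<le> \<epsilon>" using j code by auto
    finally show "(\<Sum>y | y \<in> words l \<and> ?P j y. ?f y) \<le> \<epsilon>" .
  qed
  also have "\<dots> \<le> (\<Sum>j<M. \<epsilon>)"
    using \<open>0 \<le> \<epsilon>\<close> by (intro sum_mono2) auto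
  finally show ?thesis by simp
qed

text \<open>As a function of \<open>u\<close>, \<open>q\<close> equals 1 at \<open>u = 1\<close> and
  has slope \<open>- 2 * \<delta>\<close> there, so a slightly larger \<open>u\<close> brings it
  below 1; \<open>u = 1 + \<delta>\<close> is still close enough.\<close>

lemma chernoff_base:
  fixes \<delta> :: real
  assumes "0 < \<delta>" "\<delta> \<le> 1 / 2" "u = 1 + \<delta>"
  defines "q \<equiv> 1 / u + (1 / 2 - \<delta>) * (u - 1 / u)"
  shows "0 < q" "q < 1"
proof -
  have u: "u > 1" using assms by simp
  then have "1 / u \<le> 1" by simp
  then have "1 / u \<le> u" using u by linarith
  then show "0 < q" unfolding q_def using assms(2) u
    by (intro add_pos_nonneg mult_nonneg_nonneg) auto
  have "u * q = 1 + (1 / 2 - \<delta>) * (u * u - 1)"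
    using u by (simp add: q_def field_simps)
  also have "\<dots> = u - \<delta> * \<delta> * (3 / 2 + \<delta>)"
    unfolding assms(3) by (simp add: field_simps)
  also have "\<dots> < u * 1"
    using assms(1) by simp
  finally show "q < 1" using u by (simp only: mult_less_cancel_left)
qed

subsection \<open>Separation of disjoint hulls\<close>

text \<open>Weights are total functions that vanish outside \<open>S\<close>; for finite
  \<open>S\<close> this makes the set compact in the product topology, whatever the size of the
  type.\<close>

definition prob_simplex :: "'s set \<Rightarrow> ('s \<Rightarrow> real) set" where
  "prob_simplex S = {p. (\<forall>s. 0 \<le> p s) \<and> (\<forall>s. s \<notin> S \<longrightarrow> p s = 0) \<and> sum p S = 1}"

text \<open>A closed slice of a product of compact sets, by Tychonoff's theorem; coordinates outside
  \<open>S\<close> range over \<open>{0}\<close>.\<close>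

lemma compact_prob_simplex:
  fixes S :: "'s set"
  assumes "finite S"
  shows "compact (prob_simplex S)"
proof -
  let ?B = "\<lambda>s. if s \<in> S then {0..1} else {0::real}"
  have "compactin (product_topology (\<lambda>_. euclidean) UNIV) (PiE UNIV ?B)"
    unfolding compactin_PiE by (auto simp: compactin_euclidean_iff)
  then have "compact (PiE UNIV ?B)"
    by (simp add: euclidean_product_topology compactin_euclidean_iff)
  moreover have "closed {p :: 's \<Rightarrow> real. sum p S = 1}"
    by (intro closed_Collect_eq continuous_on_sum continuous_on_product_coordinates continuous_on_const)
  moreover have "prob_simplex S = PiE UNIV ?B \<inter> {p. sum p S = 1}"
  proof (intro equalityI subsetI)
    fix p assume p: "p \<in> prob_simplex S"
    then have "p s \<le> 1" if "s \<in> S" for s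
      using member_le_sum[of s S p] that assms by (auto simp: prob_simplex_def)
    then show "p \<in> PiE UNIV ?B \<inter> {p. sum p S = 1}"
      using p by (auto simp: prob_simplex_def PiE_iff)
  next
    fix p assume p: "p \<in> PiE UNIV ?B \<inter> {p. sum p S = 1}"
    then have "p s \<in> ?B s" for s by (auto simp: PiE_iff)
    then have "0 \<le> p s" "s \<notin> S \<longrightarrow> p s = 0" for s by (metis atLeastAtMost_iff singletonD order_refl)+
    with p show "p \<in> prob_simplex S"
      by (auto simp: prob_simplex_def)
  qed
  ultimately show ?thesis by (simp add: compact_Int_closed)
qed

lemma prob_simplex_update:
  assumes "finite S" "p \<in> prob_simplex S" "s \<in> S" "0 \<le> t" "t \<le> 1"
  shows "(\<lambda>r. (1 - t) * p r + (if r = s then t else 0)) \<in> prob_simplex S"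
  using assms by (auto simp: prob_simplex_def sum.distrib sum_distrib_left[symmetric])

text \<open>First-order condition at a minimum: the squared norm of \<open>C + t * V\<close> has
  derivative twice this real part at \<open>t = 0\<close>, and a negative derivative would let a
  small step decrease it.\<close>

lemma first_variation:
  fixes C V :: "'k \<Rightarrow> complex"
  assumes "\<And>t. 0 < t \<Longrightarrow> t \<le> 1 \<Longrightarrow> (\<Sum>k\<in>K. (cmod (C k))\<^sup>2) \<le> (\<Sum>k\<in>K. (cmod (C k + of_real t * V k))\<^sup>2)"
  shows "0 \<le> Re (\<Sum>k\<in>K. cnj (C k) * V k)"
proof (rule ccontr)
  define X where "X = Re (\<Sum>k\<in>K. cnj (C k) * V k)"
  define Y where "Y = (\<Sum>k\<in>K. (cmod (V k))\<^sup>2)"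
  assume "\<not> ?thesis"
  then have X: "X < 0" by (simp add: X_def)
  have Y: "0 \<le> Y" by (simp add: Y_def sum_nonneg)
  have "(cmod (C k + of_real t * V k))\<^sup>2
      = (cmod (C k))\<^sup>2 + (2 * t * Re (cnj (C k) * V k) + t\<^sup>2 * (cmod (V k))\<^sup>2)" for t k
    unfolding cmod_power2 by (simp add: power2_eq_square algebra_simps)
  then have exp: "(\<Sum>k\<in>K. (cmod (C k + of_real t * V k))\<^sup>2) = (\<Sum>k\<in>K. (cmod (C k))\<^sup>2) + (2 * t * X + t\<^sup>2 * Y)" for t
    unfolding X_def Y_def Re_sum by (simp only: sum.distrib sum_distrib_left)
  \<comment> \<open>Chosen so that \<open>t * Y \<le> - X\<close>, which makes the increment
    \<open>t * (2 * X + t * Y)\<close> negative. The \<open>+ 1\<close> covers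
    \<open>Y = 0\<close>.\<close>
  define t where "t = min 1 (- X / (Y + 1))"
  have t: "0 < t" "t \<le> 1" using X Y by (auto simp: t_def divide_neg_pos)
  have "0 \<le> t * (2 * X + t * Y)"
    using assms[OF t] unfolding exp by (simp add: power2_eq_square algebra_simps)
  then have "0 \<le> 2 * X + t * Y" using t(1) by (simp add: zero_le_mult_iff)
  also have "t * Y \<le> - X / (Y + 1) * (Y + 1)"
    using Y X t by (intro mult_mono) (auto simp: t_def divide_nonpos_pos)
  also have "\<dots> = - X" using Y by simp
  finally show False using X by simp
qed

text \<open>Hyperplane separation for the real inner product
  \<open>Re (\<Sum>k\<in>K. cnj (C k) * x k)\<close>, with the difference of a closest pair of
  mixtures as normal vector. The formula for \<open>C\<close> is part of the conclusion because it
  shows that \<open>C\<close> is Hermitian when all the states are.\<close>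

lemma separate_hulls:
  fixes a b :: "'s \<Rightarrow> 'k \<Rightarrow> complex"
  assumes S: "finite S" "S \<noteq> {}"
    and disj: "\<And>p q. p \<in> prob_simplex S \<Longrightarrow> q \<in> prob_simplex S \<Longrightarrow>
      \<exists>k\<in>K. (\<Sum>s\<in>S. of_real (p s) * a s k) \<noteq> (\<Sum>s\<in>S. of_real (q s) * b s k)"
    and K: "finite K"
  obtains p q C \<alpha> m where "0 < (m::real)"
    "\<And>k. C k = (\<Sum>s\<in>S. of_real (p s) * a s k) - (\<Sum>s\<in>S. of_real (q s) * b s k)"
    "\<And>s. s \<in> S \<Longrightarrow> \<alpha> + m \<le> Re (\<Sum>k\<in>K. cnj (C k) * a s k)"
    "\<And>s. s \<in> S \<Longrightarrow> Re (\<Sum>k\<in>K. cnj (C k) * b s k) \<le> \<alpha> - m"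
proof -
  define mix where "mix = (\<lambda>p (a :: 's \<Rightarrow> 'k \<Rightarrow> complex) k. \<Sum>s\<in>S. of_real (p s) * a s k)"
  define f where "f = (\<lambda>(p, q). \<Sum>k\<in>K. (cmod (mix p a k - mix q b k))\<^sup>2)"
  obtain s0 where s0: "s0 \<in> S" using S by blast
  have "(\<lambda>s. if s = s0 then 1 else 0) \<in> prob_simplex S"
    using s0 S by (auto simp: prob_simplex_def)
  then have ne: "prob_simplex S \<times> prob_simplex S \<noteq> {}" by blast
  have cont: "continuous_on UNIV (\<lambda>x :: ('s \<Rightarrow> real) \<times> ('s \<Rightarrow> real). fst x s)"
    "continuous_on UNIV (\<lambda>x :: ('s \<Rightarrow> real) \<times> ('s \<Rightarrow> real). snd x s)" for s
    by (rule continuous_on_compose2[OF continuous_on_product_coordinates[of s]];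
        auto intro: continuous_on_fst continuous_on_snd continuous_on_id)+
  have "continuous_on UNIV f"
    unfolding f_def mix_def split_beta
    by (intro continuous_intros cont)
  then obtain p q where pq: "p \<in> prob_simplex S" "q \<in> prob_simplex S"
    and min: "\<And>p' q'. p' \<in> prob_simplex S \<Longrightarrow> q' \<in> prob_simplex S \<Longrightarrow> f (p, q) \<le> f (p', q')"
    using continuous_attains_inf[OF compact_Times[OF compact_prob_simplex[OF S(1)] compact_prob_simplex[OF S(1)]] ne, of f]
      continuous_on_subset[of UNIV f] by (metis (no_types, lifting) SigmaE mem_Sigma_iff subset_UNIV)
  define C where "C = (\<lambda>k. mix p a k - mix q b k)"
  define N where "N = (\<Sum>k\<in>K. (cmod (C k))\<^sup>2)"
  have fN: "f (p, q) = N" by (simp add: f_def N_def C_def)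
  obtain k where "k \<in> K" "C k \<noteq> 0" using disj[OF pq] by (auto simp: C_def mix_def)
  then have "N > 0" unfolding N_def using K by (intro sum_pos2) auto
  have mix_upd: "mix (\<lambda>r. (1 - t) * p r + (if r = s then t else 0)) a k = mix p a k + of_real t * (a s k - mix p a k)"
    if "s \<in> S" for p s t k and a :: "'s \<Rightarrow> 'k \<Rightarrow> complex"
  proof -
    have "mix (\<lambda>r. (1 - t) * p r + (if r = s then t else 0)) a k
        = (\<Sum>r\<in>S. of_real (1 - t) * (of_real (p r) * a r k) + (if r = s then of_real t * a r k else 0))"
      unfolding mix_def by (intro sum.cong) (auto simp: algebra_simps)
    also have "\<dots> = of_real (1 - t) * mix p a k + of_real t * a s k"
      using that S by (simp only: sum.distrib mix_def sum_distrib_left) simp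
    finally show ?thesis by (simp add: algebra_simps)
  qed
  \<comment> \<open>Moving the weights \<open>p\<close> towards the pure state \<open>s\<close>
    stays inside the simplex, so the closest pair satisfies the first-order condition in that
    direction.\<close>
  have A: "0 \<le> Re (\<Sum>k\<in>K. cnj (C k) * (a s k - mix p a k))" if "s \<in> S" for s
  proof (rule first_variation)
    fix t :: real assume t: "0 < t" "t \<le> 1"
    have eq: "mix p a k + of_real t * (a s k - mix p a k) - mix q b k = C k + of_real t * (a s k - mix p a k)" for k
      by (simp add: C_def)
    show "(\<Sum>k\<in>K. (cmod (C k))\<^sup>2) \<le> (\<Sum>k\<in>K. (cmod (C k + of_real t * (a s k - mix p a k)))\<^sup>2)"
      using min[OF prob_simplex_update[OF S(1) pq(1) that less_imp_le[OF t(1)] t(2)] pq(2)]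
      unfolding fN unfolding f_def prod.case mix_upd[OF that] eq N_def .
  qed
  have B: "0 \<le> Re (\<Sum>k\<in>K. cnj (C k) * (mix q b k - b s k))" if "s \<in> S" for s
  proof (rule first_variation)
    fix t :: real assume t: "0 < t" "t \<le> 1"
    have eq: "mix p a k - (mix q b k + of_real t * (b s k - mix q b k)) = C k + of_real t * (mix q b k - b s k)" for k
      by (simp add: C_def algebra_simps)
    show "(\<Sum>k\<in>K. (cmod (C k))\<^sup>2) \<le> (\<Sum>k\<in>K. (cmod (C k + of_real t * (mix q b k - b s k)))\<^sup>2)"
      using min[OF pq(1) prob_simplex_update[OF S(1) pq(2) that less_imp_le[OF t(1)] t(2)]]
      unfolding fN unfolding f_def prod.case mix_upd[OF that] eq N_def .
  qed
  define P where "P = Re (\<Sum>k\<in>K. cnj (C k) * mix p a k)"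
  define Q where "Q = Re (\<Sum>k\<in>K. cnj (C k) * mix q b k)"
  have "complex_of_real N = (\<Sum>k\<in>K. cnj (C k) * C k)"
    unfolding N_def of_real_sum complex_norm_square by (simp only: mult.commute)
  also have "\<dots> = (\<Sum>k\<in>K. cnj (C k) * mix p a k) - (\<Sum>k\<in>K. cnj (C k) * mix q b k)"
    by (subst (2) C_def) (simp only: right_diff_distrib sum_subtractf)
  finally have PQ: "P - Q = N" unfolding P_def Q_def by (metis Re_complex_of_real minus_complex.sel(1))
  show thesis
  \<comment> \<open>The threshold is midway between the values \<open>P\<close> and \<open>Q\<close>
    at the two closest points, each at distance \<open>N / 2\<close> from it since
    \<open>P - Q = N\<close>, the squared distance of the pair.\<close>
  proof (rule that[of "N / 2" C p q "(P + Q) / 2"])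
    show "0 < N / 2" using \<open>N > 0\<close> by simp
    show "C k = (\<Sum>s\<in>S. of_real (p s) * a s k) - (\<Sum>s\<in>S. of_real (q s) * b s k)" for k
      by (simp add: C_def mix_def)
    fix s assume s: "s \<in> S"
    have "P \<le> Re (\<Sum>k\<in>K. cnj (C k) * a s k)"
      using A[OF s] by (simp only: right_diff_distrib sum_subtractf minus_complex.sel P_def)
    then show "(P + Q) / 2 + N / 2 \<le> Re (\<Sum>k\<in>K. cnj (C k) * a s k)"
      using PQ by (simp add: field_simps)
    have "Re (\<Sum>k\<in>K. cnj (C k) * b s k) \<le> Q"
      using B[OF s] by (simp only: right_diff_distrib sum_subtractf minus_complex.sel Q_def)
    then show "Re (\<Sum>k\<in>K. cnj (C k) * b s k) \<le> (P + Q) / 2 - N / 2"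
      using PQ by (simp add: field_simps)
  qed
qed

section \<open>Convex hulls as images of the simplex\<close>

definition mixture :: "nat \<Rightarrow> 's set \<Rightarrow> ('s \<Rightarrow> complex mat) \<Rightarrow> ('s \<Rightarrow> real) \<Rightarrow> complex mat" where
  "mixture d S B p = mat d d (\<lambda>ij. \<Sum>s\<in>S. of_real (p s) * B s $$ ij)"

lemma mat_sum_carrier:
  "set Ms \<subseteq> carrier_mat n n \<Longrightarrow> mat_sum n Ms \<in> carrier_mat n n"
  by (induction Ms) (auto simp: mat_sum_def)

lemma mat_sum_index:
  "set Ms \<subseteq> carrier_mat n n \<Longrightarrow> i < n \<Longrightarrow> j < n \<Longrightarrow> mat_sum n Ms $$ (i,j) = (\<Sum>M\<leftarrow>Ms. M $$ (i,j))"
proof (induction Ms)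
  case (Cons M Ms)
  then show ?case using mat_sum_carrier[of Ms n] by (simp add: mat_sum_def)
qed (simp add: mat_sum_def)

text \<open>A matrix may occur several times in the list and may be the output of several states;
  each entry's weight is credited to one state that produces its matrix. The total weight is left
  arbitrary so that induction on the list goes through.\<close>

lemma weights_of_list:
  assumes "finite S" "\<forall>(c,M)\<in>set ps. 0 \<le> c \<and> M \<in> B ` S"
  shows "\<exists>p. (\<forall>s. 0 \<le> p s) \<and> (\<forall>s. s \<notin> S \<longrightarrow> p s = 0) \<and> sum p S = sum_list (map fst ps) \<and>
    (\<forall>ij. (\<Sum>s\<in>S. complex_of_real (p s) * B s $$ ij) = (\<Sum>(c,M)\<leftarrow>ps. of_real c * M $$ ij))"
  using assms(2)
proof (induction ps)
  case Nil
  show ?case by (intro exI[of _ "\<lambda>_. 0"]) simp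
next
  case (Cons x ps)
  obtain c M where x: "x = (c, M)" by force
  then obtain s where s: "s \<in> S" "M = B s" "0 \<le> c" using Cons.prems by auto
  obtain p where p: "\<And>s. 0 \<le> p s" "\<And>s. s \<notin> S \<Longrightarrow> p s = 0" "sum p S = sum_list (map fst ps)"
    "\<And>ij. (\<Sum>s\<in>S. complex_of_real (p s) * B s $$ ij) = (\<Sum>(c,M)\<leftarrow>ps. of_real c * M $$ ij)"
    using Cons by auto
  let ?p = "\<lambda>r. p r + (if r = s then c else 0)"
  have "(\<Sum>r\<in>S. complex_of_real (?p r) * B r $$ ij)
      = (\<Sum>r\<in>S. complex_of_real (p r) * B r $$ ij + (if r = s then of_real c * M $$ ij else 0))" for ij
    using s by (intro sum.cong) (auto simp: algebra_simps)
  then show ?case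
    using p s assms(1) by (intro exI[of _ ?p]) (auto simp: x sum.distrib)
qed

text \<open>Trades lists of unbounded length for weights on \<open>S\<close>: a compact parameter
  space for the direct part, and the jammer's distributions for the converse.\<close>

lemma conv_mat_eq_mixture:
  assumes "finite S" and B: "\<And>s. s \<in> S \<Longrightarrow> B s \<in> carrier_mat d d"
  shows "conv_mat d (B ` S) = mixture d S B ` prob_simplex S"
proof (intro equalityI subsetI)
  fix C assume "C \<in> conv_mat d (B ` S)"
  then obtain ps where ps: "\<forall>(c,M) \<in> set ps. 0 \<le> c \<and> M \<in> B ` S" "sum_list (map fst ps) = 1"
    and C: "C = mat_sum d (map (\<lambda>(c,M). complex_of_real c \<cdot>\<^sub>m M) ps)"
    by (auto simp: conv_mat_def)
  obtain p where p: "\<And>s. 0 \<le> p s" "\<And>s. s \<notin> S \<Longrightarrow> p s = 0" "sum p S = 1"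
    "\<And>ij. (\<Sum>s\<in>S. complex_of_real (p s) * B s $$ ij) = (\<Sum>(c,M)\<leftarrow>ps. of_real c * M $$ ij)"
    using weights_of_list[OF assms(1) ps(1)] ps(2) by auto
  have carr: "M \<in> carrier_mat d d" if "(c, M) \<in> set ps" for c M using ps(1) B that by fastforce
  then have sub: "set (map (\<lambda>(c,M). complex_of_real c \<cdot>\<^sub>m M) ps) \<subseteq> carrier_mat d d" by auto
  have "C = mixture d S B p"
  proof (rule eq_matI)
    fix i j assume "i < dim_row (mixture d S B p)" "j < dim_col (mixture d S B p)"
    then have ij: "i < d" "j < d" by (simp_all add: mixture_def)
    have "C $$ (i,j) = (\<Sum>(c,M)\<leftarrow>ps. (complex_of_real c \<cdot>\<^sub>m M) $$ (i,j))"
      unfolding C mat_sum_index[OF sub ij] by (simp add: comp_def case_prod_unfold)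
    also have "\<dots> = (\<Sum>(c,M)\<leftarrow>ps. of_real c * M $$ (i,j))"
      using carr ij by (intro arg_cong[of _ _ sum_list] map_cong) fastforce+
    finally show "C $$ (i,j) = mixture d S B p $$ (i,j)" using ij p(4) by (simp add: mixture_def)
  qed (use mat_sum_carrier[OF sub] in \<open>auto simp: C mixture_def\<close>)
  then show "C \<in> mixture d S B ` prob_simplex S" using p by (auto simp: prob_simplex_def)
next
  fix C assume "C \<in> mixture d S B ` prob_simplex S"
  then obtain p where p: "p \<in> prob_simplex S" and C: "C = mixture d S B p" by blast
  obtain xs where xs: "set xs = S" "distinct xs" using finite_distinct_list[OF assms(1)] by blast
  let ?ps = "map (\<lambda>s. (p s, B s)) xs"
  have sub: "set (map (\<lambda>(c,M). complex_of_real c \<cdot>\<^sub>m M) ?ps) \<subseteq> carrier_mat d d" using B xs by auto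
  have "C = mat_sum d (map (\<lambda>(c,M). complex_of_real c \<cdot>\<^sub>m M) ?ps)"
  proof (rule eq_matI)
    fix i j assume "i < dim_row (mat_sum d (map (\<lambda>(c,M). complex_of_real c \<cdot>\<^sub>m M) ?ps))"
      "j < dim_col (mat_sum d (map (\<lambda>(c,M). complex_of_real c \<cdot>\<^sub>m M) ?ps))"
    then have ij: "i < d" "j < d" using mat_sum_carrier[OF sub] by auto
    have "mat_sum d (map (\<lambda>(c,M). complex_of_real c \<cdot>\<^sub>m M) ?ps) $$ (i,j)
        = (\<Sum>s\<in>S. (complex_of_real (p s) \<cdot>\<^sub>m B s) $$ (i,j))"
      unfolding mat_sum_index[OF sub ij] using xs by (simp add: comp_def sum_list_distinct_conv_sum_set)
    also have "\<dots> = (\<Sum>s\<in>S. of_real (p s) * B s $$ (i,j))"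
      using B ij by (intro sum.cong) fastforce+
    finally show "C $$ (i,j) = mat_sum d (map (\<lambda>(c,M). complex_of_real c \<cdot>\<^sub>m M) ?ps) $$ (i,j)"
      using ij by (simp add: C mixture_def)
  qed (use mat_sum_carrier[OF sub] in \<open>auto simp: C mixture_def\<close>)
  moreover have "sum_list (map fst ?ps) = 1"
    using p xs by (simp add: comp_def sum_list_distinct_conv_sum_set prob_simplex_def)
  moreover from this have "?ps \<noteq> []" by force
  moreover have "\<forall>(c,M) \<in> set ?ps. 0 \<le> c \<and> M \<in> B ` S"
    using p xs by (auto simp: prob_simplex_def)
  ultimately show "C \<in> conv_mat d (B ` S)"
    unfolding conv_mat_def by blast
qed

text \<open>The sum of the moduli of all entries is a crude stand-in for the operator norm,
  sufficient for choosing a small enough perturbation.\<close>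

lemma sesq_bound:
  "cmod (sesq n h v) \<le> (\<Sum>i<n. \<Sum>j<n. cmod (h i j)) * (\<Sum>k<n. (cmod (v k))\<^sup>2)"
proof -
  let ?N = "\<Sum>k<n. (cmod (v k))\<^sup>2"
  have vv: "cmod (v i) * cmod (v j) \<le> ?N" if "i < n" "j < n" for i j
  proof -
    have "(cmod (v k))\<^sup>2 \<le> ?N" if "k < n" for k
      using that by (intro member_le_sum) auto
    from this[OF that(1)] this[OF that(2)] show ?thesis
      using sum_squares_bound[of "cmod (v i)" "cmod (v j)"] by linarith
  qed
  have "cmod (sesq n h v) \<le> (\<Sum>i<n. \<Sum>j<n. cmod (cnj (v i) * h i j * v j))"
    unfolding sesq_def by (intro order_trans[OF norm_sum] sum_mono norm_sum)
  also have "\<dots> \<le> (\<Sum>i<n. \<Sum>j<n. cmod (h i j) * ?N)"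
  proof (intro sum_mono)
    fix i j assume "i \<in> {..<n}" "j \<in> {..<n}"
    then have "cmod (h i j) * (cmod (v i) * cmod (v j)) \<le> cmod (h i j) * ?N"
      by (intro mult_left_mono vv) auto
    then show "cmod (cnj (v i) * h i j * v j) \<le> cmod (h i j) * ?N"
      by (simp add: norm_mult mult_ac)
  qed
  finally show ?thesis by (simp only: sum_distrib_right)
qed

text \<open>The condition bounds \<open>\<bar>\<epsilon>\<bar>\<close>, so the lemma covers an
  effect and also its complement, where \<open>\<epsilon>\<close> changes sign.\<close>

lemma psd_half_perturbation:
  assumes herm: "\<And>i j. i < n \<Longrightarrow> j < n \<Longrightarrow> cnj (h i j) = h j i"
    and \<epsilon>: "\<bar>\<epsilon>\<bar> * (\<Sum>i<n. \<Sum>j<n. cmod (h i j)) \<le> 1 / 2"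
  shows "psd n (mat n n (\<lambda>(i,j). (if i = j then 1 / 2 else 0) + of_real \<epsilon> * h i j))"
  unfolding psd_iff_sesq
proof (intro conjI allI impI)
  fix v
  let ?N = "\<Sum>k<n. (cmod (v k))\<^sup>2" and ?H = "\<Sum>i<n. \<Sum>j<n. cmod (h i j)"
  have "sesq n (\<lambda>i j. mat n n (\<lambda>(i,j). (if i = j then 1 / 2 else 0) + of_real \<epsilon> * h i j) $$ (i,j)) v
      = (\<Sum>i<n. \<Sum>j<n. (if i = j then cnj (v i) * v j / 2 else 0) + of_real \<epsilon> * (cnj (v i) * h i j * v j))"
    unfolding sesq_def by (intro sum.cong refl) (simp add: algebra_simps)
  also have "\<dots> = (\<Sum>i<n. v i * cnj (v i)) / 2 + of_real \<epsilon> * sesq n h v"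
    by (simp add: sum.distrib sum_distrib_left[symmetric] sesq_def sum_divide_distrib mult.commute)
  also have "(\<Sum>i<n. v i * cnj (v i)) = of_real ?N"
    by (simp only: of_real_sum complex_norm_square)
  finally have eq: "Re (sesq n (\<lambda>i j. mat n n (\<lambda>(i,j). (if i = j then 1 / 2 else 0) + of_real \<epsilon> * h i j) $$ (i,j)) v)
      = ?N / 2 + \<epsilon> * Re (sesq n h v)" by simp
  have "\<bar>\<epsilon> * Re (sesq n h v)\<bar> \<le> \<bar>\<epsilon>\<bar> * (?H * ?N)"
    unfolding abs_mult by (intro mult_left_mono order_trans[OF abs_Re_le_cmod sesq_bound]) auto
  also have "\<dots> \<le> 1 / 2 * ?N"
    unfolding mult.assoc[symmetric] by (intro mult_right_mono \<epsilon> sum_nonneg) auto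
  finally show "0 \<le> Re (sesq n (\<lambda>i j. mat n n (\<lambda>(i,j). (if i = j then 1 / 2 else 0) + of_real \<epsilon> * h i j) $$ (i,j)) v)"
    unfolding eq by linarith
qed (use herm in auto)

lemma separating_effect:
  assumes S: "finite S" "S \<noteq> {}"
    and A: "\<And>s. s \<in> S \<Longrightarrow> density d (A s)" and B: "\<And>s. s \<in> S \<Longrightarrow> density d (B s)"
    and disj: "conv_mat d (A ` S) \<inter> conv_mat d (B ` S) = {}"
  obtains E \<delta> where "0 < \<delta>" "\<delta> \<le> 1 / 2" "psd d E" "psd d (1\<^sub>m d - E)"
    "\<And>s. s \<in> S \<Longrightarrow> 1 / 2 + \<delta> \<le> Re (mtrace (A s * E))"
    "\<And>s. s \<in> S \<Longrightarrow> Re (mtrace (B s * E)) \<le> 1 / 2 - \<delta>"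
proof -
  let ?K = "{..<d} \<times> {..<d}"
  note A' = A[unfolded density_def] and B' = B[unfolded density_def]
  have carr: "A s \<in> carrier_mat d d" "B s \<in> carrier_mat d d" if "s \<in> S" for s
    using A'[OF that] B'[OF that] by (simp_all add: psd_carrier)
  have disj': "\<exists>k\<in>?K. (\<Sum>s\<in>S. of_real (p s) * A s $$ k) \<noteq> (\<Sum>s\<in>S. of_real (q s) * B s $$ k)"
    if pq: "p \<in> prob_simplex S" "q \<in> prob_simplex S" for p q
  proof (rule ccontr)
    assume "\<not> ?thesis"
    then have "mixture d S A p = mixture d S B q" by (auto simp: mixture_def intro!: eq_matI)
    then show False
      using disj pq conv_mat_eq_mixture[of S A d] conv_mat_eq_mixture[of S B d] carr S(1) by auto
  qed
  obtain p q C \<alpha> m where m: "0 < (m::real)"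
    and C: "\<And>k. C k = (\<Sum>s\<in>S. of_real (p s) * A s $$ k) - (\<Sum>s\<in>S. of_real (q s) * B s $$ k)"
    and CA: "\<And>s. s \<in> S \<Longrightarrow> \<alpha> + m \<le> Re (\<Sum>k\<in>?K. cnj (C k) * A s $$ k)"
    and CB: "\<And>s. s \<in> S \<Longrightarrow> Re (\<Sum>k\<in>?K. cnj (C k) * B s $$ k) \<le> \<alpha> - m"
    by (rule separate_hulls[where K = ?K and a = "\<lambda>s k. A s $$ k" and b = "\<lambda>s k. B s $$ k", OF S])
      (rule disj', assumption+, simp, rule that, assumption+)
  have hermC: "cnj (C (i,j)) = C (j,i)" if "i < d" "j < d" for i j
  proof -
    have "cnj (A s $$ (i,j)) = A s $$ (j,i)" "cnj (B s $$ (i,j)) = B s $$ (j,i)" if "s \<in> S" for s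
      using A'[OF that] B'[OF that] \<open>i < d\<close> \<open>j < d\<close> unfolding psd_iff_sesq by blast+
    then show ?thesis by (simp add: C)
  qed
  \<comment> \<open>Subtracting \<open>\<alpha>\<close> on the diagonal moves the threshold to 0 on
    matrices of trace one; adding half the identity then places it at \<open>1 / 2\<close>.\<close>
  define h where "h = (\<lambda>i j. C (i,j) - (if i = j then of_real \<alpha> else 0))"
  define H where "H = (\<Sum>i<d. \<Sum>j<d. cmod (h i j))"
  have H: "0 \<le> H" unfolding H_def by (intro sum_nonneg) auto
  define \<epsilon> where "\<epsilon> = 1 / (2 * (H + 1))"
  have \<epsilon>: "0 < \<epsilon>" "\<epsilon> * H \<le> 1 / 2" using H by (auto simp: \<epsilon>_def field_simps)
  define E where "E = mat d d (\<lambda>(i,j). (if i = j then 1 / 2 else 0) + of_real \<epsilon> * h i j)"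
  have hermh: "cnj (h i j) = h j i" if "i < d" "j < d" for i j using hermC[OF that] by (simp add: h_def)
  have E: "psd d E" unfolding E_def
    by (rule psd_half_perturbation) (use hermh \<epsilon> in \<open>auto simp: H_def[symmetric]\<close>)
  have "1\<^sub>m d - E = mat d d (\<lambda>(i,j). (if i = j then 1 / 2 else 0) + of_real (- \<epsilon>) * h i j)"
    by (rule eq_matI) (auto simp: E_def)
  also have "psd d \<dots>"
    by (rule psd_half_perturbation) (use hermh \<epsilon> in \<open>auto simp: H_def[symmetric]\<close>)
  finally have E': "psd d (1\<^sub>m d - E)" .
  have tr: "Re (mtrace (R * E)) = 1 / 2 + \<epsilon> * (Re (\<Sum>k\<in>?K. cnj (C k) * R $$ k) - \<alpha>)"
    if R: "density d R" for R
  proof -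
    have Rc: "R \<in> carrier_mat d d" and tr1: "mtrace R = 1" using R by (auto simp: density_def psd_carrier)
    have "mtrace (R * E) = (\<Sum>i<d. \<Sum>j<d. (if j = i then (1 / 2 - of_real (\<epsilon> * \<alpha>)) * R $$ (i,i) else 0)
        + of_real \<epsilon> * (cnj (C (i,j)) * R $$ (i,j)))"
      unfolding mtrace_mult[OF Rc psd_carrier[OF E]]
      by (intro sum.cong refl) (auto simp: E_def h_def hermC algebra_simps)
    also have "\<dots> = (1 / 2 - of_real (\<epsilon> * \<alpha>)) * mtrace R + of_real \<epsilon> * (\<Sum>i<d. \<Sum>j<d. cnj (C (i,j)) * R $$ (i,j))"
      using Rc by (simp add: sum.distrib sum_distrib_left mtrace_def)
    also have "(\<Sum>i<d. \<Sum>j<d. cnj (C (i,j)) * R $$ (i,j)) = (\<Sum>k\<in>?K. cnj (C k) * R $$ k)"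
      by (simp add: sum.cartesian_product)
    finally have eq: "mtrace (R * E)
        = (1 / 2 - of_real (\<epsilon> * \<alpha>)) * mtrace R + of_real \<epsilon> * (\<Sum>k\<in>?K. cnj (C k) * R $$ k)" .
    show ?thesis unfolding eq tr1 by (simp add: algebra_simps del: Re_sum Im_sum)
  qed
  show thesis
  \<comment> \<open>The gap is cut off at \<open>1 / 2\<close> to meet the requirement
    \<open>\<delta> \<le> 1 / 2\<close> of \<open>chernoff_base\<close>.\<close>
  proof (rule that[of "min (\<epsilon> * m) (1 / 2)" E])
    show "0 < min (\<epsilon> * m) (1 / 2)" using \<epsilon> m by simp
    fix s assume s: "s \<in> S"
    have "\<epsilon> * m \<le> \<epsilon> * (Re (\<Sum>k\<in>?K. cnj (C k) * A s $$ k) - \<alpha>)"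
      using CA[OF s] \<epsilon> by (intro mult_left_mono) auto
    then show "1 / 2 + min (\<epsilon> * m) (1 / 2) \<le> Re (mtrace (A s * E))"
      unfolding tr[OF A[OF s]] by linarith
    have "\<epsilon> * (Re (\<Sum>k\<in>?K. cnj (C k) * B s $$ k) - \<alpha>) \<le> \<epsilon> * (- m)"
      using CB[OF s] \<epsilon> by (intro mult_left_mono) auto
    then show "Re (mtrace (B s * E)) \<le> 1 / 2 - min (\<epsilon> * m) (1 / 2)"
      unfolding tr[OF B[OF s]] by linarith
  qed (use E E' in auto)
qed

subsection \<open>Codes for the channel\<close>

text \<open>The dimension is an argument so that an empty sum is the \<open>n\<close> by
  \<open>n\<close> zero matrix.\<close>

definition matrix_sum :: "nat \<Rightarrow> ('a \<Rightarrow> complex mat) \<Rightarrow> 'a set \<Rightarrow> complex mat" where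
  "matrix_sum n f Y = mat n n (\<lambda>ij. \<Sum>y\<in>Y. f y $$ ij)"

lemma matrix_sum_carrier [simp]: "matrix_sum n f Y \<in> carrier_mat n n"
  by (simp add: matrix_sum_def)

lemma matrix_sum_index: "i < n \<Longrightarrow> j < n \<Longrightarrow> matrix_sum n f Y $$ (i,j) = (\<Sum>y\<in>Y. f y $$ (i,j))"
  by (simp add: matrix_sum_def)

lemma psd_matrix_sum:
  assumes "\<And>y. y \<in> Y \<Longrightarrow> psd n (f y)"
  shows "psd n (matrix_sum n f Y)"
proof -
  have "sesq n (\<lambda>i j. matrix_sum n f Y $$ (i,j)) v = (\<Sum>y\<in>Y. sesq n (\<lambda>i j. f y $$ (i,j)) v)" for v
    unfolding sesq_def
    by (subst sum.swap, subst (2) sum.swap) (auto simp: matrix_sum_index sum_distrib_left sum_distrib_right intro!: sum.cong)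
  then show ?thesis
    unfolding psd_iff_sesq using assms by (auto simp: psd_iff_sesq matrix_sum_index Re_sum intro!: sum_nonneg sum.cong)
qed

lemma mtrace_mult_matrix_sum:
  assumes "\<rho> \<in> carrier_mat n n" "\<And>y. y \<in> Y \<Longrightarrow> f y \<in> carrier_mat n n"
  shows "mtrace (\<rho> * matrix_sum n f Y) = (\<Sum>y\<in>Y. mtrace (\<rho> * f y))"
proof -
  have "(\<Sum>y\<in>Y. mtrace (\<rho> * f y)) = (\<Sum>y\<in>Y. \<Sum>i<n. \<Sum>j<n. \<rho> $$ (i,j) * f y $$ (j,i))"
    using assms by (intro sum.cong mtrace_mult) auto
  also have "\<dots> = (\<Sum>i<n. \<Sum>j<n. \<Sum>y\<in>Y. \<rho> $$ (i,j) * f y $$ (j,i))"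
    by (subst sum.swap, subst (2) sum.swap) (rule refl)
  also have "\<dots> = mtrace (\<rho> * matrix_sum n f Y)"
    unfolding mtrace_mult[OF assms(1) matrix_sum_carrier]
    by (intro sum.cong refl) (simp add: matrix_sum_index sum_distrib_left)
  finally show ?thesis by simp
qed

lemma mat_sum_eq_matrix_sum:
  assumes "\<And>i. i < M \<Longrightarrow> D i \<in> carrier_mat n n"
  shows "mat_sum n (map D [0..<M]) = matrix_sum n D {..<M}"
proof -
  have sub: "set (map D [0..<M]) \<subseteq> carrier_mat n n" using assms by auto
  show ?thesis
  proof (rule eq_matI)
    fix i j assume "i < dim_row (matrix_sum n D {..<M})" "j < dim_col (matrix_sum n D {..<M})"
    then have ij: "i < n" "j < n" by (simp_all add: matrix_sum_def)
    have "mat_sum n (map D [0..<M]) $$ (i,j) = (\<Sum>k<M. D k $$ (i,j))"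
      unfolding mat_sum_index[OF sub ij]
      by (simp add: comp_def interv_sum_list_conv_sum_set_nat atLeast0LessThan)
    then show "mat_sum n (map D [0..<M]) $$ (i,j) = matrix_sum n D {..<M} $$ (i,j)"
      using ij by (simp add: matrix_sum_index)
  qed (use mat_sum_carrier[OF sub] in \<open>auto simp: matrix_sum_def\<close>)
qed

lemma matrix_sum_UNION:
  fixes M :: nat
  assumes "\<And>i. i < M \<Longrightarrow> finite (Y i)" "\<And>i j. i < M \<Longrightarrow> j < M \<Longrightarrow> i \<noteq> j \<Longrightarrow> Y i \<inter> Y j = {}"
  shows "matrix_sum n (\<lambda>i. matrix_sum n f (Y i)) {..<M} = matrix_sum n f (\<Union>i<M. Y i)"
proof (rule eq_matI)
  fix i j assume "i < dim_row (matrix_sum n f (\<Union>i<M. Y i))" "j < dim_col (matrix_sum n f (\<Union>i<M. Y i))"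
  then have ij: "i < n" "j < n" by (simp_all add: matrix_sum_def)
  have "(\<Sum>y\<in>(\<Union>i<M. Y i). f y $$ (i,j)) = (\<Sum>k<M. \<Sum>y\<in>Y k. f y $$ (i,j))"
    using assms by (intro sum.UNION_disjoint) auto
  then show "matrix_sum n (\<lambda>i. matrix_sum n f (Y i)) {..<M} $$ (i,j) = matrix_sum n f (\<Union>i<M. Y i) $$ (i,j)"
    using ij by (simp add: matrix_sum_index)
qed (simp_all add: matrix_sum_def)

lemma mtrace_mult_one_minus:
  assumes "\<rho> \<in> carrier_mat n n" "D \<in> carrier_mat n n"
  shows "mtrace (\<rho> * (1\<^sub>m n - D)) = mtrace \<rho> - mtrace (\<rho> * D)"
proof -
  have "mtrace (\<rho> * (1\<^sub>m n - D)) = (\<Sum>i<n. \<Sum>j<n. (if j = i then \<rho> $$ (i,i) else 0) - \<rho> $$ (i,j) * D $$ (j,i))"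
    using assms by (subst mtrace_mult[OF assms(1)]) (auto intro!: sum.cong simp: algebra_simps)
  then show ?thesis
    unfolding mtrace_mult[OF assms] using assms(1) by (simp add: sum_subtractf mtrace_def)
qed

lemma one_minus_matrix_sum:
  assumes "finite W" "Y \<subseteq> W" "matrix_sum n f W = 1\<^sub>m n"
  shows "1\<^sub>m n - matrix_sum n f Y = matrix_sum n f (W - Y)"
  unfolding assms(3)[symmetric]
  by (rule eq_matI) (use assms(1,2) in \<open>auto simp: matrix_sum_def sum_diff\<close>)

text \<open>Expanding the tensor power of \<open>E True + E False\<close> shows that measuring every
  position is a complete measurement of the block.\<close>

lemma matrix_sum_words:
  fixes E :: "bool \<Rightarrow> complex mat"
  assumes "\<And>b. E b \<in> carrier_mat d d" and one: "E True + E False = 1\<^sub>m d"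
  shows "matrix_sum (d ^ l) (\<lambda>y. tensor_seq l (\<lambda>k. E (y k))) (words l) = 1\<^sub>m (d ^ l)"
proof (rule eq_matI)
  fix i j assume "i < dim_row (1\<^sub>m (d ^ l))" "j < dim_col (1\<^sub>m (d ^ l))"
  then have ij: "i < d ^ l" "j < d ^ l" by simp_all
  have E1: "1\<^sub>m d $$ (a, b) = E False $$ (a, b) + E True $$ (a, b)" if "a < d" "b < d" for a b
    unfolding one[symmetric] using that assms(1)[of True] assms(1)[of False]
    by (subst index_add_mat) auto
  have "tensor_seq l (\<lambda>_. 1\<^sub>m d) $$ (i,j) = (\<Sum>y\<in>words l. (\<Prod>k<l. 1) * tensor_seq l (\<lambda>k. E (y k)) $$ (i,j))"
    by (rule tensor_seq_sum_index[where d = d and G = "\<lambda>_. E"]) (use assms(1) ij in \<open>simp_all add: UNIV_bool E1 del: index_one_mat(1)\<close>)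
  then show "matrix_sum (d ^ l) (\<lambda>y. tensor_seq l (\<lambda>k. E (y k))) (words l) $$ (i,j) = 1\<^sub>m (d ^ l) $$ (i,j)"
    using ij by (simp add: matrix_sum_index tensor_seq_one)
qed (simp_all add: matrix_sum_def)

section \<open>Bounds on the maximal error\<close>

lemma finite_errors:
  "finite S \<Longrightarrow> finite {f s i | s i. s \<in> {..<l} \<rightarrow>\<^sub>E S \<and> i < (M::nat)}" for l :: nat
  by (rule finite_image_set2) (auto intro: finite_PiE)

lemma max_err_ge:
  assumes "finite S" "s \<in> {..<l} \<rightarrow>\<^sub>E S" "i < M"
  shows "Re (mtrace (tensor_seq l (\<lambda>k. A (s k) (cw i k)) * (1\<^sub>m (d ^ l) - D i))) \<le> max_err S d A l M cw D"
  unfolding max_err_def using assms by (intro Max_ge finite_errors) auto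

lemma max_err_le:
  assumes "finite S" "S \<noteq> {}" "1 \<le> M"
    and "\<And>s i. s \<in> {..<l} \<rightarrow>\<^sub>E S \<Longrightarrow> i < M \<Longrightarrow>
      Re (mtrace (tensor_seq l (\<lambda>k. A (s k) (cw i k)) * (1\<^sub>m (d ^ l) - D i))) \<le> e"
  shows "max_err S d A l M cw D \<le> e"
proof -
  let ?V = "{Re (mtrace (tensor_seq l (\<lambda>k. A (s k) (cw i k)) * (1\<^sub>m (d ^ l) - D i))) | s i.
      s \<in> {..<l} \<rightarrow>\<^sub>E S \<and> i < M}"
  obtain s where s: "s \<in> {..<l} \<rightarrow>\<^sub>E S" using assms(2) PiE_eq_empty_iff[of "{..<l}" "\<lambda>_. S"] by blast
  have "0 < M" using assms(3) by simp
  with s have "?V \<noteq> {}" by blast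
  moreover have "finite ?V" using assms(1) by (rule finite_errors)
  ultimately show ?thesis
    unfolding max_err_def using assms(4) by (intro Max.boundedI) auto
qed

text \<open>The decoder groups the outcomes of the product measurement by nearest codeword. State
  and outcome operators are both products, so for fixed \<open>s\<close> the measured word has a
  product law and \<open>decoding_error\<close> applies; the resulting bound is the same for all
  \<open>s\<close> and \<open>i\<close>.\<close>

lemma exists_det_code:
  fixes A :: "'s \<Rightarrow> 'x \<Rightarrow> complex mat"
  assumes S: "finite S" "S \<noteq> {}" and "avcqc S X d A" and xX: "x \<in> X" "x' \<in> X"
    and \<delta>: "0 < \<delta>" "\<delta> \<le> 1 / 2" and E: "psd d E" "psd d (1\<^sub>m d - E)"
    and Ax: "\<And>s. s \<in> S \<Longrightarrow> 1 / 2 + \<delta> \<le> Re (mtrace (A s x * E))"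
    and Ax': "\<And>s. s \<in> S \<Longrightarrow> Re (mtrace (A s x' * E)) \<le> 1 / 2 - \<delta>"
    and u: "u = 1 + \<delta>" and q: "q = 1 / u + (1 / 2 - \<delta>) * (u - 1 / u)"
    and \<theta>: "0 < \<theta>" "1 + q = 2 * \<theta>\<^sup>2" and M: "1 \<le> M" "real M * \<theta> ^ l \<le> 1"
  shows "\<exists>cw D. det_code X d l M cw D \<and> 0 \<le> max_err S d A l M cw D \<and> max_err S d A l M cw D \<le> real M * \<theta> ^ l"
proof -
  have "1 < u" using \<delta> u by simp
  have q0: "0 < q" using chernoff_base(1)[OF \<delta> u] q by simp
  obtain c where c: "\<And>i j. i < M \<Longrightarrow> j < M \<Longrightarrow> i \<noteq> j \<Longrightarrow> hweight q l (c i) (c j) \<le> \<theta> ^ l"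
    using exists_code[OF q0 \<theta> M(2)] by blast
  define F where "F = (\<lambda>b. if b then E else 1\<^sub>m d - E)"
  have F: "psd d (F b)" for b using E by (simp add: F_def)
  note Fc = psd_carrier[OF F]
  have FF: "F True + F False = 1\<^sub>m d"
    by (rule eq_matI) (use psd_carrier[OF E(1)] in \<open>auto simp: F_def\<close>)
  define T where "T = (\<lambda>y. tensor_seq l (\<lambda>k. F (y k)))"
  define dec where "dec = decoding_set u l M c"
  define cw where "cw = (\<lambda>i k. if c i k then x else x')"
  define D where "D = (\<lambda>i. matrix_sum (d ^ l) T (dec i))"
  have T: "psd (d ^ l) (T y)" for y unfolding T_def by (intro psd_tensor_seq F)
  have W: "matrix_sum (d ^ l) T (words l) = 1\<^sub>m (d ^ l)"
    unfolding T_def using Fc FF by (rule matrix_sum_words)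
  have fin: "finite (words l)" by (intro finite_PiE) auto
  have dec: "dec i \<subseteq> words l" for i by (auto simp: dec_def decoding_set_def)
  have disj: "dec i \<inter> dec j = {}" if "i < M" "j < M" "i \<noteq> j" for i j
    using that by (force simp: dec_def decoding_set_def)
  have D: "psd (d ^ l) (D i)" for i unfolding D_def by (intro psd_matrix_sum T)
  have D': "1\<^sub>m (d ^ l) - D i = matrix_sum (d ^ l) T (words l - dec i)" for i
    unfolding D_def by (intro one_minus_matrix_sum fin dec W)
  have "mat_sum (d ^ l) (map D [0..<M]) = matrix_sum (d ^ l) D {..<M}"
    by (intro mat_sum_eq_matrix_sum psd_carrier D)
  also have "\<dots> = matrix_sum (d ^ l) T (\<Union>i<M. dec i)"
    unfolding D_def using finite_subset[OF dec fin] disj by (rule matrix_sum_UNION)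
  also have "1\<^sub>m (d ^ l) - \<dots> = matrix_sum (d ^ l) T (words l - (\<Union>i<M. dec i))"
    using dec by (intro one_minus_matrix_sum fin W) auto
  also have "psd (d ^ l) \<dots>" by (intro psd_matrix_sum T)
  finally have code: "det_code X d l M cw D"
    using D xX by (simp add: det_code_def cw_def)
  have dens: "density d (A s (cw i k))" if "s \<in> S" for s i k
    using assms(3) that xX by (auto simp: avcqc_def cw_def)
  have Apsd: "psd d (A s (cw i k))" and Atr: "mtrace (A s (cw i k)) = 1" if "s \<in> S" for s i k
    using dens[OF that, of i k] by (simp_all add: density_def)
  have err: "Re (mtrace (tensor_seq l (\<lambda>k. A (s k) (cw i k)) * (1\<^sub>m (d ^ l) - D i)))
      \<in> {0..real M * \<theta> ^ l}" if s: "s \<in> {..<l} \<rightarrow>\<^sub>E S" and i: "i < M" for s i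
  proof -
    have sk: "s k \<in> S" if "k < l" for k using s that by auto
    \<comment> \<open>The law of the bit measured at position \<open>k\<close> under this jamming
      sequence.\<close>
    define w where "w = (\<lambda>k b. Re (mtrace (A (s k) (cw i k) * F b)))"
    have w: "mtrace (A (s k) (cw i k) * F b) = of_real (w k b)" "0 \<le> w k b" if "k < l" for k b
      using mtrace_psd_mult[OF Apsd[OF sk[OF that], of i k] F[of b]] unfolding w_def
      by (metis Re_complex_of_real)+
    have w1: "w k True + w k False = 1" if "k < l" for k
    proof -
      have "mtrace (A (s k) (cw i k) * (1\<^sub>m d - E)) = mtrace (A (s k) (cw i k)) - mtrace (A (s k) (cw i k) * E)"
        using Apsd[OF sk[OF that]] E(1) by (intro mtrace_mult_one_minus psd_carrier)
      then show ?thesis using Atr[OF sk[OF that]] by (simp add: w_def F_def)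
    qed
    have wd: "w k (\<not> c i k) \<le> 1 / 2 - \<delta>" if "k < l" for k
    proof (cases "c i k")
      case True
      then have "1 / 2 + \<delta> \<le> w k True" using Ax[OF sk[OF that]] by (simp add: w_def F_def cw_def)
      with True w1[OF that] show ?thesis by simp
    next
      case False
      then show ?thesis using Ax'[OF sk[OF that]] by (simp add: w_def F_def cw_def)
    qed
    let ?\<rho> = "tensor_seq l (\<lambda>k. A (s k) (cw i k))"
    have \<rho>: "?\<rho> \<in> carrier_mat (d ^ l) (d ^ l)"
      using Apsd sk by (intro tensor_seq_carrier psd_carrier) auto
    have "mtrace (?\<rho> * (1\<^sub>m (d ^ l) - D i)) = (\<Sum>y\<in>words l - dec i. mtrace (?\<rho> * T y))"
      unfolding D' by (intro mtrace_mult_matrix_sum \<rho> psd_carrier T)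
    also have "\<dots> = (\<Sum>y\<in>words l - dec i. \<Prod>k<l. mtrace (A (s k) (cw i k) * F (y k)))"
      unfolding T_def using Apsd sk F by (intro sum.cong refl mtrace_tensor_seq_mult[where d = d] psd_carrier) auto
    also have "\<dots> = of_real (\<Sum>y\<in>words l - dec i. \<Prod>k<l. w k (y k))"
      by (simp add: w)
    finally have eq: "Re (mtrace (?\<rho> * (1\<^sub>m (d ^ l) - D i))) = (\<Sum>y\<in>words l - dec i. \<Prod>k<l. w k (y k))"
      by (simp only: Re_complex_of_real)
    have "(\<Sum>y\<in>words l - dec i. \<Prod>k<l. w k (y k)) \<le> real M * \<theta> ^ l"
      unfolding dec_def using w(2) w1 wd \<open>1 < u\<close> q
      by (rule decoding_error[where w = w and c = c and i = i]) (use c i \<theta> in auto)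
    moreover have "0 \<le> (\<Sum>y\<in>words l - dec i. \<Prod>k<l. w k (y k))"
      by (intro sum_nonneg prod_nonneg) (auto simp: w)
    ultimately show ?thesis unfolding eq by simp
  qed
  have "max_err S d A l M cw D \<le> real M * \<theta> ^ l"
    using S M(1) by (rule max_err_le) (use err in auto)
  moreover have "0 \<le> max_err S d A l M cw D"
  proof -
    obtain s where s: "s \<in> {..<l} \<rightarrow>\<^sub>E S" using S(2) PiE_eq_empty_iff[of "{..<l}" "\<lambda>_. S"] by blast
    have "0 \<le> Re (mtrace (tensor_seq l (\<lambda>k. A (s k) (cw 0 k)) * (1\<^sub>m (d ^ l) - D 0)))"
      using err[OF s, of 0] M(1) by simp
    also have "\<dots> \<le> max_err S d A l M cw D"
      using S(1) s M(1) by (intro max_err_ge) auto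
    finally show ?thesis .
  qed
  ultimately show ?thesis using code by blast
qed

lemma exists_positive_rate:
  assumes S: "finite S" "S \<noteq> {}" and A: "avcqc S X d A" and "\<not> m_symmetrizable S X d A"
  shows "\<exists>R>0. achievable_max S X d A R"
proof -
  obtain x x' where xX: "x \<in> X" "x' \<in> X"
    and disj: "conv_mat d ((\<lambda>s. A s x) ` S) \<inter> conv_mat d ((\<lambda>s. A s x') ` S) = {}"
    using assms(4) by (auto simp: m_symmetrizable_def)
  have "density d (A s x)" "density d (A s x')" if "s \<in> S" for s
    using A xX that by (auto simp: avcqc_def)
  then obtain E \<delta> where \<delta>: "0 < \<delta>" "\<delta> \<le> 1 / 2" and E: "psd d E" "psd d (1\<^sub>m d - E)"
    and Ax: "\<And>s. s \<in> S \<Longrightarrow> 1 / 2 + \<delta> \<le> Re (mtrace (A s x * E))"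
    and Ax': "\<And>s. s \<in> S \<Longrightarrow> Re (mtrace (A s x' * E)) \<le> 1 / 2 - \<delta>"
    using separating_effect[OF S, where A = "\<lambda>s. A s x" and B = "\<lambda>s. A s x'" and d = d] disj by metis
  define u where "u = 1 + \<delta>"
  define q where "q = 1 / u + (1 / 2 - \<delta>) * (u - 1 / u)"
  have q: "0 < q" "q < 1" using chernoff_base[OF \<delta> u_def] by (simp_all add: q_def)
  \<comment> \<open>A fourth root: \<open>\<theta> = t\<^sup>2\<close> then solves
    \<open>1 + q = 2 * \<theta>\<^sup>2\<close>, and about \<open>(1 / t) ^ l\<close> codewords
    leave the bound \<open>M l * \<theta> ^ l \<le> t ^ l\<close>, which tends to 0.\<close>
  define t where "t = sqrt (sqrt ((1 + q) / 2))"
  have t: "0 < t" "t < 1" using q by (simp_all add: t_def)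
  have "(t\<^sup>2)\<^sup>2 = (1 + q) / 2" using q by (simp add: t_def)
  then have \<theta>: "0 < t\<^sup>2" "1 + q = 2 * (t\<^sup>2)\<^sup>2" using t by simp_all
  define M where "M = (\<lambda>l::nat. nat \<lfloor>(1 / t) ^ l\<rfloor>)"
  have ge1: "1 \<le> (1 / t) ^ l" for l using t by (intro one_le_power) simp
  then have fl: "1 \<le> \<lfloor>(1 / t) ^ l\<rfloor>" for l by simp
  have rM: "real (M l) = of_int \<lfloor>(1 / t) ^ l\<rfloor>" for l using fl[of l] by (simp add: M_def)
  have M1: "1 \<le> M l" for l using fl[of l] unfolding M_def by linarith
  have M_le: "real (M l) \<le> (1 / t) ^ l" for l unfolding rM by (rule of_int_floor_le)
  have M_ge: "(1 / t) ^ l / 2 \<le> real (M l)" for l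
    using M1[of l] real_of_int_floor_add_one_gt[of "(1 / t) ^ l"] unfolding rM[symmetric] by linarith
  have Mt: "real (M l) * (t\<^sup>2) ^ l \<le> t ^ l" for l
  proof -
    have "real (M l) * (t\<^sup>2) ^ l \<le> (1 / t) ^ l * (t\<^sup>2) ^ l"
      using M_le by (rule mult_right_mono) simp
    also have "\<dots> = t ^ l" using t by (simp add: power_mult_distrib[symmetric] power2_eq_square)
    finally show ?thesis .
  qed
  have "real (M l) * (t\<^sup>2) ^ l \<le> 1" for l
    using Mt[of l] power_le_one[of t l] t by linarith
  then have "\<exists>cw D. det_code X d l (M l) cw D \<and> 0 \<le> max_err S d A l (M l) cw D \<and>
      max_err S d A l (M l) cw D \<le> real (M l) * (t\<^sup>2) ^ l" for l
    by (intro exists_det_code[OF S A xX \<delta> E Ax Ax' u_def q_def \<theta> M1])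
  then obtain cw D where code: "\<And>l. det_code X d l (M l) (cw l) (D l)"
    and err0: "\<And>l. 0 \<le> max_err S d A l (M l) (cw l) (D l)"
    and err: "\<And>l. max_err S d A l (M l) (cw l) (D l) \<le> real (M l) * (t\<^sup>2) ^ l"
    by metis
  have lim: "(\<lambda>l. max_err S d A l (M l) (cw l) (D l)) \<longlonglongrightarrow> 0"
  proof (rule tendsto_sandwich[OF _ _ tendsto_const LIMSEQ_realpow_zero])
    show "\<forall>\<^sub>F l in sequentially. max_err S d A l (M l) (cw l) (D l) \<le> t ^ l"
      using order_trans[OF err Mt] by simp
  qed (use err0 t in auto)
  \<comment> \<open>Half of the exponent \<open>log 2 (1 / t)\<close>: the other half absorbs the
    factor 2 lost by rounding down, as soon as \<open>R * l \<ge> 1\<close>.\<close>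
  define R where "R = log 2 (1 / t) / 2"
  have R: "0 < R" using t by (simp add: R_def)
  have "R \<le> log 2 (real (M l)) / real l" if "1 / R \<le> real l" for l
  proof -
    have "0 < 1 / R" using R by simp
    then have l: "0 < real l" using that by linarith
    have "1 \<le> R * real l" using that R by (simp add: field_simps)
    then have "R * real l \<le> 2 * R * real l - 1" by simp
    also have "\<dots> = log 2 ((1 / t) ^ l / 2)"
      using t by (simp add: log_divide log_nat_power R_def)
    also have "\<dots> \<le> log 2 (real (M l))"
      using t M_ge M1[of l] by (subst log_le_cancel_iff) auto
    finally show ?thesis using l by (simp add: field_simps)
  qed
  then have "\<forall>\<^sub>F l in sequentially. ereal R \<le> ereal (log 2 (real (M l)) / real l)"
    using eventually_ge_at_top[of "nat \<lceil>1 / R\<rceil>"] by (auto elim!: eventually_mono)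
  then have "ereal R \<le> liminf (\<lambda>l. ereal (log 2 (real (M l)) / real l))"
    by (rule Liminf_bounded)
  then have "achievable_max S X d A R"
    unfolding achievable_max_def using R M1 code lim
    by (intro conjI exI[of _ M] exI[of _ cw] exI[of _ D]) auto
  then show ?thesis using R by blast
qed

section \<open>The converse for m-symmetrizable channels\<close>

lemma symmetrizable_max_err_ge:
  fixes S :: "'s set"
  assumes S: "finite S" and A: "avcqc S X d A" and sym: "m_symmetrizable S X d A"
    and code: "det_code X d l M cw D" and M: "2 \<le> M"
  shows "1 / 2 \<le> max_err S d A l M cw D"
proof -
  have cwX: "cw i k \<in> X" if "i < M" "k < l" for i k
    using code that by (simp add: det_code_def)
  have D: "psd (d ^ l) (D i)" if "i < M" for i
    using code that by (simp add: det_code_def)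
  have dens: "density d (A s (cw i k))" if "s \<in> S" "i < M" "k < l" for s i k
    using A cwX that by (auto simp: avcqc_def)
  have Apsd: "psd d (A s (cw i k))" and Atr: "mtrace (A s (cw i k)) = 1"
    if "s \<in> S" "i < M" "k < l" for s i k
    using dens[OF that] by (simp_all add: density_def)
  \<comment> \<open>The weights may differ between the two codewords because \<open>max_err\<close>
    maximizes over pairs of a jamming sequence and a codeword.\<close>
  have "\<exists>p p'. p \<in> prob_simplex S \<and> p' \<in> prob_simplex S \<and>
      mixture d S (\<lambda>s. A s (cw 0 k)) p = mixture d S (\<lambda>s. A s (cw 1 k)) p'" if "k < l" for k
  proof -
    have *: "conv_mat d ((\<lambda>s. A s (cw i k)) ` S) = mixture d S (\<lambda>s. A s (cw i k)) ` prob_simplex S"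
      if "i < M" for i
      using S Apsd \<open>k < l\<close> that by (intro conv_mat_eq_mixture psd_carrier) auto
    have "conv_mat d ((\<lambda>s. A s (cw 0 k)) ` S) \<inter> conv_mat d ((\<lambda>s. A s (cw 1 k)) ` S) \<noteq> {}"
      using sym cwX that M by (simp add: m_symmetrizable_def)
    then show ?thesis using *[of 0] *[of 1] M by auto
  qed
  then obtain p p' where p: "\<And>k. k < l \<Longrightarrow> p k \<in> prob_simplex S" "\<And>k. k < l \<Longrightarrow> p' k \<in> prob_simplex S"
    and eq: "\<And>k. k < l \<Longrightarrow> mixture d S (\<lambda>s. A s (cw 0 k)) (p k) = mixture d S (\<lambda>s. A s (cw 1 k)) (p' k)"
    by metis
  define \<rho> where "\<rho> = tensor_seq l (\<lambda>k. mixture d S (\<lambda>s. A s (cw 0 k)) (p k))"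
  have \<rho>: "\<rho> \<in> carrier_mat (d ^ l) (d ^ l)"
    unfolding \<rho>_def by (rule tensor_seq_carrier) (simp add: mixture_def)
  \<comment> \<open>\<open>\<rho>\<close> is built from codeword 0, but expands over the pure
    outputs of any codeword \<open>i\<close> whose mixtures agree with it at every position.\<close>
  have average: "Re (mtrace (\<rho> * Y)) = (\<Sum>s\<in>{..<l} \<rightarrow>\<^sub>E S. (\<Prod>k<l. r k (s k)) *
      Re (mtrace (tensor_seq l (\<lambda>k. A (s k) (cw i k)) * Y)))"
    if Y: "Y \<in> carrier_mat (d ^ l) (d ^ l)" and i: "i < M"
      and r: "\<And>k. k < l \<Longrightarrow> mixture d S (\<lambda>s. A s (cw 0 k)) (p k) = mixture d S (\<lambda>s. A s (cw i k)) (r k)"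
    for Y i r
  proof -
    have "mtrace (\<rho> * Y) = (\<Sum>s\<in>{..<l} \<rightarrow>\<^sub>E S. (\<Prod>k<l. complex_of_real (r k (s k))) *
        mtrace (tensor_seq l (\<lambda>k. A (s k) (cw i k)) * Y))"
      unfolding \<rho>_def
    proof (rule mtrace_tensor_seq_sum_mult[where G = "\<lambda>k s. A s (cw i k)" and c = "\<lambda>k s. of_real (r k s)", OF _ _ S _ Y])
      show "mixture d S (\<lambda>s. A s (cw 0 k)) (p k) $$ (a,b) = (\<Sum>s\<in>S. of_real (r k s) * A s (cw i k) $$ (a,b))"
        if "k < l" "a < d" "b < d" for k a b
        unfolding r[OF that(1)] using that by (simp add: mixture_def)
    qed (use Apsd i in \<open>auto simp: mixture_def psd_carrier\<close>)
    then show ?thesis by (simp flip: of_real_prod)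
  qed
  have total: "(\<Sum>s\<in>{..<l} \<rightarrow>\<^sub>E S. \<Prod>k<l. r k (s k)) = 1" if "\<And>k. k < l \<Longrightarrow> r k \<in> prob_simplex S"
    for r :: "nat \<Rightarrow> 's \<Rightarrow> real"
    using that S by (subst prod_sum_PiE[symmetric]) (auto simp: prob_simplex_def)
  have weight: "0 \<le> (\<Prod>k<l. r k (s k))" if "\<And>k. k < l \<Longrightarrow> r k \<in> prob_simplex S"     for r and s :: "nat \<Rightarrow> 's"
    using that by (intro prod_nonneg) (auto simp: prob_simplex_def)
  have upper: "1 - Re (mtrace (\<rho> * D i)) \<le> max_err S d A l M cw D"
    if i: "i < M" and r: "\<And>k. k < l \<Longrightarrow> r k \<in> prob_simplex S"
      "\<And>k. k < l \<Longrightarrow> mixture d S (\<lambda>s. A s (cw 0 k)) (p k) = mixture d S (\<lambda>s. A s (cw i k)) (r k)"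
      and \<rho>1: "Re (mtrace \<rho>) = 1" for i r
  proof -
    have "1 - Re (mtrace (\<rho> * D i)) = Re (mtrace (\<rho> * (1\<^sub>m (d ^ l) - D i)))"
      using mtrace_mult_one_minus[OF \<rho> psd_carrier[OF D[OF i]]] \<rho>1 by simp
    also have "\<dots> = (\<Sum>s\<in>{..<l} \<rightarrow>\<^sub>E S. (\<Prod>k<l. r k (s k)) *
        Re (mtrace (tensor_seq l (\<lambda>k. A (s k) (cw i k)) * (1\<^sub>m (d ^ l) - D i))))"
      using psd_carrier[OF D[OF i]] i r(2) by (intro average) auto
    also have "\<dots> \<le> (\<Sum>s\<in>{..<l} \<rightarrow>\<^sub>E S. (\<Prod>k<l. r k (s k)) * max_err S d A l M cw D)"
      using S i r(1) by (intro sum_mono mult_left_mono max_err_ge weight)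
    also have "\<dots> = max_err S d A l M cw D"
      using total[OF r(1)] by (simp add: sum_distrib_right[symmetric])
    finally show ?thesis .
  qed
  have M0: "0 < M" "1 < M" using M by simp_all
  have tens: "psd (d ^ l) (tensor_seq l (\<lambda>k. A (s k) (cw 0 k)))" "mtrace (tensor_seq l (\<lambda>k. A (s k) (cw 0 k))) = 1"
    if "s \<in> {..<l} \<rightarrow>\<^sub>E S" for s
  proof -
    have *: "psd d (A (s k) (cw 0 k))" "mtrace (A (s k) (cw 0 k)) = 1" if "k < l" for k
      using Apsd[OF _ M0(1) that] Atr[OF _ M0(1) that] \<open>s \<in> _\<close> that by auto
    show "psd (d ^ l) (tensor_seq l (\<lambda>k. A (s k) (cw 0 k)))" using * by (intro psd_tensor_seq)
    show "mtrace (tensor_seq l (\<lambda>k. A (s k) (cw 0 k))) = 1"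
      using * by (subst mtrace_tensor_seq[where d = d]) (auto simp: psd_carrier)
  qed
  \<comment> \<open>The sign is inherited from the pure outputs of codeword 0, of which
    \<open>\<rho>\<close> is a convex combination.\<close>
  have lower: "0 \<le> Re (mtrace (\<rho> * Y))" if Y: "psd (d ^ l) Y" for Y
    unfolding average[OF psd_carrier[OF Y] M0(1) refl]
  proof (intro sum_nonneg mult_nonneg_nonneg weight p)
    fix s assume "s \<in> {..<l} \<rightarrow>\<^sub>E S"
    then show "0 \<le> Re (mtrace (tensor_seq l (\<lambda>k. A (s k) (cw 0 k)) * Y))"
      using mtrace_psd_mult[OF tens(1) Y] by (metis Re_complex_of_real)
  qed
  have \<rho>1: "Re (mtrace \<rho>) = 1"
  proof -
    have "Re (mtrace \<rho>) = Re (mtrace (\<rho> * 1\<^sub>m (d ^ l)))" using \<rho> by simp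
    also have "\<dots> = (\<Sum>s\<in>{..<l} \<rightarrow>\<^sub>E S. (\<Prod>k<l. p k (s k)) *
        Re (mtrace (tensor_seq l (\<lambda>k. A (s k) (cw 0 k)) * 1\<^sub>m (d ^ l))))"
      by (rule average[OF one_carrier_mat M0(1) refl])
    also have "\<dots> = (\<Sum>s\<in>{..<l} \<rightarrow>\<^sub>E S. (\<Prod>k<l. p k (s k)))"
    proof (rule sum.cong[OF refl])
      fix s assume "s \<in> {..<l} \<rightarrow>\<^sub>E S"
      note t = tens[OF this]
      show "(\<Prod>k<l. p k (s k)) * Re (mtrace (tensor_seq l (\<lambda>k. A (s k) (cw 0 k)) * 1\<^sub>m (d ^ l))) = (\<Prod>k<l. p k (s k))"
        using t(2) right_mult_one_mat[OF psd_carrier[OF t(1)]] by simp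
    qed
    finally show ?thesis using total[OF p(1)] by simp
  qed
  have Dsum: "mat_sum (d ^ l) (map D [0..<M]) = matrix_sum (d ^ l) D {..<M}"
    using D by (intro mat_sum_eq_matrix_sum psd_carrier)
  then have "0 \<le> Re (mtrace (\<rho> * (1\<^sub>m (d ^ l) - matrix_sum (d ^ l) D {..<M})))"
    using code by (intro lower) (simp add: det_code_def)
  also have "\<dots> = 1 - (\<Sum>i<M. Re (mtrace (\<rho> * D i)))"
    using \<rho>1 D by (subst mtrace_mult_one_minus[OF \<rho> matrix_sum_carrier], subst mtrace_mult_matrix_sum[OF \<rho>])
      (auto simp: psd_carrier)
  finally have "(\<Sum>i<M. Re (mtrace (\<rho> * D i))) \<le> 1" by simp
  moreover have "(\<Sum>i\<in>{0,1}. Re (mtrace (\<rho> * D i))) \<le> (\<Sum>i<M. Re (mtrace (\<rho> * D i)))"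
    using M0 D lower by (intro sum_mono2) auto
  moreover have "1 - Re (mtrace (\<rho> * D 0)) \<le> max_err S d A l M cw D"
    using M0(1) p(1) refl \<rho>1 by (rule upper)
  moreover have "1 - Re (mtrace (\<rho> * D 1)) \<le> max_err S d A l M cw D"
    using M0(2) p(2) eq \<rho>1 by (rule upper)
  ultimately show ?thesis by simp
qed

lemma symmetrizable_achievable_zero:
  assumes S: "finite S" and A: "avcqc S X d A" and sym: "m_symmetrizable S X d A"
    and "achievable_max S X d A R"
  shows "R = 0"
proof (rule ccontr)
  assume "R \<noteq> 0"
  then have R: "0 < R" using assms(4) by (simp add: achievable_max_def)
  obtain M cw D where code: "\<And>l. det_code X d l (M l) (cw l) (D l)"
    and rate: "ereal R \<le> liminf (\<lambda>l. ereal (log 2 (real (M l)) / real l))"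
    and err: "(\<lambda>l. max_err S d A l (M l) (cw l) (D l)) \<longlonglongrightarrow> 0"
    using assms(4) by (auto simp: achievable_max_def)
  have "\<forall>\<^sub>F l in sequentially. (0::ereal) < ereal (log 2 (real (M l)) / real l)"
    by (rule less_LiminfD) (use R rate in \<open>auto intro: less_le_trans[of 0 "ereal R"]\<close>)
  moreover have "\<forall>\<^sub>F l in sequentially. max_err S d A l (M l) (cw l) (D l) < 1 / 2"
    by (rule order_tendstoD(2)[OF err]) simp
  ultimately have "\<forall>\<^sub>F l in sequentially. False"
  proof eventually_elim
    case (elim l)
    have "\<not> M l \<le> 1"
    proof
      assume "M l \<le> 1"
      \<comment> \<open>For \<open>M l = 0\<close> the logarithm takes the default value
        \<open>ln 0 = 0\<close>, so this case contradicts a positive rate just as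
        \<open>M l = 1\<close> does.\<close>
      then have "M l = 0 \<or> M l = 1" by linarith
      then show False using elim(1) by (auto simp: log_def)
    qed
    then show False using symmetrizable_max_err_ge[OF S A sym code, of l] elim(2) by simp
  qed
  then show False by simp
qed

text \<open>Some rate must be achievable for the capacity to be 0, as the supremum of the empty set
  of extended reals is \<open>-\<infinity>\<close>. A single codeword decoded by the identity never
  errs.\<close>

lemma achievable_zero:
  assumes "finite S" "S \<noteq> {}" "X \<noteq> {}" "avcqc S X d A"
  shows "achievable_max S X d A 0"
proof -
  obtain x where x: "x \<in> X" using assms(3) by blast
  have one: "mat_sum n [1\<^sub>m n] = 1\<^sub>m n" for n by (simp add: mat_sum_def)
  have diff: "1\<^sub>m n - 1\<^sub>m n = (0\<^sub>m n n :: complex mat)" for n by (rule eq_matI) auto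
  have "psd n (0\<^sub>m n n)" for n by (rule psd_of_gram[where K = "{}"]) auto
  then have code: "det_code X d l 1 (\<lambda>_ _. x) (\<lambda>_. 1\<^sub>m (d ^ l))" for l
    using x psd_one by (simp add: det_code_def one diff)
  have tr0: "mtrace (tensor_seq l (\<lambda>k. A (s k) x) * 0\<^sub>m (d ^ l) (d ^ l)) = 0" if "s \<in> {..<l} \<rightarrow>\<^sub>E S" for s l
  proof -
    have "A (s k) x \<in> carrier_mat d d" if "k < l" for k
      using assms(4) x \<open>s \<in> _\<close> that by (auto simp: avcqc_def density_def psd_def)
    then have "tensor_seq l (\<lambda>k. A (s k) x) \<in> carrier_mat (d ^ l) (d ^ l)"
      by (rule tensor_seq_carrier)
    then show ?thesis by (simp add: mtrace_def)
  qed
  have "max_err S d A l 1 (\<lambda>_ _. x) (\<lambda>_. 1\<^sub>m (d ^ l)) = 0" for l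
  proof (rule antisym)
    show "max_err S d A l 1 (\<lambda>_ _. x) (\<lambda>_. 1\<^sub>m (d ^ l)) \<le> 0"
      by (rule max_err_le) (use assms in \<open>simp_all add: diff tr0\<close>)
    obtain s where s: "s \<in> {..<l} \<rightarrow>\<^sub>E S" using assms(2) PiE_eq_empty_iff[of "{..<l}" "\<lambda>_. S"] by blast
    show "0 \<le> max_err S d A l 1 (\<lambda>_ _. x) (\<lambda>_. 1\<^sub>m (d ^ l))"
      using max_err_ge[OF assms(1) s, of 0 1 A "\<lambda>_ _. x" d "\<lambda>_. 1\<^sub>m (d ^ l)"] tr0[OF s]
      by (simp add: diff)
  qed
  then show ?thesis
    unfolding achievable_max_def using code
    by (intro conjI exI[of _ "\<lambda>_. 1"] exI[of _ "\<lambda>_ _ _. x"] exI[of _ "\<lambda>l _. 1\<^sub>m (d ^ l)"])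
      (auto simp: zero_ereal_def[symmetric] Liminf_const)
qed

theorem theorem4:
  fixes S :: "'s set" and X :: "'x set" and d :: nat and A :: "'s \<Rightarrow> 'x \<Rightarrow> complex mat"
  assumes "finite S" "S \<noteq> {}" "finite X" "X \<noteq> {}" "0 < d"
    and "avcqc S X d A"
  shows "cap_max_det S X d A = 0 \<longleftrightarrow> m_symmetrizable S X d A"
proof
  assume "cap_max_det S X d A = 0"
  then have "R \<le> 0" if "achievable_max S X d A R" for R
    using that Sup_upper[of "ereal R" "ereal ` {R. achievable_max S X d A R}"]
    by (simp add: cap_max_det_def)
  then show "m_symmetrizable S X d A"
    using exists_positive_rate[OF assms(1,2,6)] by fastforce
next
  assume "m_symmetrizable S X d A"
  then have "{R. achievable_max S X d A R} = {0}"
    using symmetrizable_achievable_zero[OF assms(1,6)] achievable_zero[OF assms(1,2,4,6)] by blast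
  then show "cap_max_det S X d A = 0" by (simp add: cap_max_det_def)
qed

end
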